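(* Let $S=\{1,\ldots,n\}$ with $n\geq 2$ be the state space of a Markov decision process (MDP) with a reachability objective with target state $s^*=n$ and finite nonempty action sets $A(s)$, $s\in S$. Suppose that for each state $s\in S\setminus\{n\}$ and each action $a\in A(s)$ the transition distribution $(p(z\mid s,a))_{z\in S}$ is drawn at random, independently over all such pairs $(s,a)$, from some continuous distribution (i.e. one having a density with respect to $(n-1)$-dimensional Lebesgue measure, possibly depending on $(s,a)$) on $\{(q_1,\ldots,q_n)\in(0,1)^n : q_1+\cdots+q_n=1\}$. Then, with probability 1 over this draw, there is a pure stationary strategy that overtakes each other stationary strategy at each initial state $s\in S\setminus\{n\}$ (where stationary strategies that differ only at the target state $n$ are identified).
   Context: An MDP with a reachability objective is given by a finite set $S$ of states with a target state $s^*\in S$, for each $s\in S$ a nonempty finite set $A(s)$ of actions, and for each $s\in S$, $a\in A(s)$ a probability distribution $p(\cdot\mid s,a)$ on $S$. Play runs over periods $1,2,3,\ldots$: it starts at period 1 in an initial state $s_1\in S\setminus\{s^*\}$; at each period $t$ the decision maker chooses an action $a_t\in A(s_t)$ and $s_{t+1}$ is drawn from $p(\cdot\mid s_t,a_t)$. A stationary strategy $\sigma$ assigns to each state $s$ a probability distribution $\sigma(s)$ on $A(s)$, which is used to choose the action whenever the current state is $s$; it is pure if each $\sigma(s)$ puts probability 1 on one action. $\mathbb{P}_{s\sigma}$ denotes the probability measure on infinite histories $(s_1,a_1,s_2,a_2,\ldots)$ induced by initial state $s$ and strategy $\sigma$. Let $t^*$ be the first period at which the state is $s^*$ ($t^*=\infty$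 if $s^*$ is never reached). A strategy $\sigma$ overtakes a strategy $\sigma'$ at the initial state $s$ if there is $T\in\mathbb{N}$ such that $\mathbb{P}_{s\sigma}(t^*\leq t)>\mathbb{P}_{s\sigma'}(t^*\leq t)$ for all $t\geq T$. *)

theory Defs
  imports "HOL-Probability.Probability"
begin

definition mdp :: "'s set \<Rightarrow> 's \<Rightarrow> ('s \<Rightarrow> 'a set) \<Rightarrow> ('s \<Rightarrow> 'a \<Rightarrow> 's pmf) \<Rightarrow> bool" where
  "mdp S target A p \<longleftrightarrow>
     finite S \<and> target \<in> S \<and>
     (\<forall>s\<in>S. finite (A s) \<and> A s \<noteq> {}) \<and>
     (\<forall>s\<in>S. \<forall>a\<in>A s. set_pmf (p s a) \<subseteq> S)"

definition stationary_strategy :: "'s set \<Rightarrow> ('s \<Rightarrow> 'a set) \<Rightarrow> ('s \<Rightarrow> 'a pmf) \<Rightarrow> bool" where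
  "stationary_strategy S A \<sigma> \<longleftrightarrow> (\<forall>s\<in>S. set_pmf (\<sigma> s) \<subseteq> A s)"

definition pure_stationary_strategy :: "'s set \<Rightarrow> ('s \<Rightarrow> 'a set) \<Rightarrow> ('s \<Rightarrow> 'a pmf) \<Rightarrow> bool" where
  "pure_stationary_strategy S A \<sigma> \<longleftrightarrow>
     stationary_strategy S A \<sigma> \<and> (\<forall>s\<in>S. \<exists>a\<in>A s. \<sigma> s = return_pmf a)"

text \<open>
  A history \<open>h :: nat \<Rightarrow> 's \<times> 'a\<close> stores the state and action of period \<open>t \<ge> 1\<close> at index
  \<open>t - 1\<close>. The law of histories is the Ionescu-Tulcea measure of the kernels below; the kernel
  with index \<open>i\<close> is the conditional law of \<open>h i\<close> given \<open>h 0, \<dots>, h (i - 1)\<close>.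
\<close>

definition history_kernel ::
  "('s \<Rightarrow> 'a \<Rightarrow> 's pmf) \<Rightarrow> ('s \<Rightarrow> 'a pmf) \<Rightarrow> 's \<Rightarrow> nat \<Rightarrow> (nat \<Rightarrow> 's \<times> 'a) \<Rightarrow> ('s \<times> 'a) measure" where
  "history_kernel p \<sigma> s i h = measure_pmf (do {
     z \<leftarrow> (if i = 0 then return_pmf s else case h (i - 1) of (s', a') \<Rightarrow> p s' a');
     a \<leftarrow> \<sigma> z;
     return_pmf (z, a) })"

definition history_measure ::
  "('s \<Rightarrow> 'a \<Rightarrow> 's pmf) \<Rightarrow> ('s \<Rightarrow> 'a pmf) \<Rightarrow> 's \<Rightarrow> (nat \<Rightarrow> 's \<times> 'a) measure" where
  "history_measure p \<sigma> s =
     projective_family.lim UNIV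
       (Ionescu_Tulcea.CI (history_kernel p \<sigma> s) (\<lambda>_. count_space UNIV))
       (\<lambda>_. count_space UNIV)"

lemma Ionescu_Tulcea_history_kernel:
  fixes p :: "'s \<Rightarrow> 'a \<Rightarrow> 's pmf"
  shows "Ionescu_Tulcea (history_kernel p \<sigma> s) (\<lambda>_. count_space UNIV)"
proof (rule Ionescu_Tulcea.intro)
  fix i :: nat
  let ?N = "PiM {0..<i} (\<lambda>_. count_space UNIV) :: (nat \<Rightarrow> 's \<times> 'a) measure"
  show "history_kernel p \<sigma> s i \<in> measurable ?N (subprob_algebra (count_space UNIV))"
  proof (cases i)
    case 0
    then show ?thesis
      by (simp add: history_kernel_def[abs_def] measure_pmf_in_subprob_algebra)
  next
    case (Suc j)
    have "(\<lambda>h. h j) \<in> measurable ?N (count_space UNIV)"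
      by (rule measurable_component_singleton) (simp add: Suc)
    moreover have "(\<lambda>x. measure_pmf (do {
        z \<leftarrow> (case x of (s', a') \<Rightarrow> p s' a'); a \<leftarrow> \<sigma> z; return_pmf (z, a) }))
        \<in> measurable (count_space UNIV) (subprob_algebra (count_space UNIV))"
      by (auto intro: measure_pmf_in_subprob_algebra)
    ultimately show ?thesis
      unfolding history_kernel_def[abs_def] using Suc by (simp add: measurable_compose)
  qed
next
  fix i :: nat and h :: "nat \<Rightarrow> 's \<times> 'a"
  show "prob_space (history_kernel p \<sigma> s i h)"
    unfolding history_kernel_def
    by (rule measure_pmf.prob_space_axioms)
qed

lemma sets_history_measure:
  "sets (history_measure p \<sigma> s) = sets (PiM UNIV (\<lambda>_. count_space UNIV))"
proof -
  interpret Ionescu_Tulcea "history_kernel p \<sigma> s" "\<lambda>_. count_space UNIV"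
    by (rule Ionescu_Tulcea_history_kernel)
  show ?thesis
    unfolding history_measure_def by simp
qed

definition state_at :: "(nat \<Rightarrow> 's \<times> 'a) \<Rightarrow> nat \<Rightarrow> 's" where
  "state_at h t = fst (h (t - 1))"

definition hitting_period :: "'s \<Rightarrow> (nat \<Rightarrow> 's \<times> 'a) \<Rightarrow> enat" where
  "hitting_period target h = Inf {enat t | t. 1 \<le> t \<and> state_at h t = target}"

definition reach_prob ::
  "('s \<Rightarrow> 'a \<Rightarrow> 's pmf) \<Rightarrow> 's \<Rightarrow> 's \<Rightarrow> ('s \<Rightarrow> 'a pmf) \<Rightarrow> nat \<Rightarrow> real" where
  "reach_prob p target s \<sigma> t =
     measure (history_measure p \<sigma> s)
       {h \<in> space (history_measure p \<sigma> s). hitting_period target h \<le> enat t}"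

definition overtakes ::
  "('s \<Rightarrow> 'a \<Rightarrow> 's pmf) \<Rightarrow> 's \<Rightarrow> 's \<Rightarrow> ('s \<Rightarrow> 'a pmf) \<Rightarrow> ('s \<Rightarrow> 'a pmf) \<Rightarrow> bool" where
  "overtakes p target s \<sigma> \<sigma>' \<longleftrightarrow>
     (\<exists>T. \<forall>t\<ge>T. reach_prob p target s \<sigma> t > reach_prob p target s \<sigma>' t)"

definition open_simplex :: "nat \<Rightarrow> (nat \<Rightarrow> real) set" where
  "open_simplex n = {q \<in> {1..n} \<rightarrow>\<^sub>E {0<..<1}. (\<Sum>i=1..n. q i) = 1}"

text \<open>
  The hyperplane carrying the simplex is parametrised by the first \<open>n - 1\<close> coordinates. Up to the
  constant factor \<open>sqrt n\<close>, which does not affect the existence of densities, the measure below is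
  the \<open>(n - 1)\<close>-dimensional Lebesgue measure.
\<close>

definition simplex_borel :: "nat \<Rightarrow> (nat \<Rightarrow> real) measure" where
  "simplex_borel n = restrict_space (PiM {1..n} (\<lambda>_. borel)) (open_simplex n)"

definition simplex_chart :: "nat \<Rightarrow> (nat \<Rightarrow> real) \<Rightarrow> nat \<Rightarrow> real" where
  "simplex_chart n x = x(n := 1 - (\<Sum>i=1..<n. x i))"

definition simplex_lebesgue :: "nat \<Rightarrow> (nat \<Rightarrow> real) measure" where
  "simplex_lebesgue n =
     distr
       (restrict_space (PiM {1..<n} (\<lambda>_. lborel)) {x. simplex_chart n x \<in> open_simplex n})
       (simplex_borel n)
       (simplex_chart n)"

text \<open>The pushforward is not degenerate: the chart is measurable on its domain.\<close>

lemma measurable_simplex_chart: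
  assumes "n \<ge> 1"
  shows "simplex_chart n \<in>
    measurable
      (restrict_space (PiM {1..<n} (\<lambda>_. lborel)) {x. simplex_chart n x \<in> open_simplex n})
      (simplex_borel n)"
proof -
  have "(\<lambda>x. simplex_chart n x i) \<in> borel_measurable (PiM {1..<n} (\<lambda>_. lborel))"
    if "i \<in> {1..n}" for i
  proof (cases "i = n")
    case True
    then show ?thesis
      unfolding simplex_chart_def
      by (auto intro!: borel_measurable_diff borel_measurable_sum measurable_component_singleton)
  next
    case False
    with that have "i \<in> {1..<n}"
      by auto
    from measurable_component_singleton[OF this, of "\<lambda>_. lborel"] False show ?thesis
      by (simp add: simplex_chart_def)
  qed
  moreover have "simplex_chart n x \<in> extensional {1..n}"
    if "x \<in> space (PiM {1..<n} (\<lambda>_. lborel))" for x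
    using that assms
    by (auto simp: simplex_chart_def space_PiM PiE_def extensional_def)
  ultimately have *: "simplex_chart n \<in>
      measurable (PiM {1..<n} (\<lambda>_. lborel)) (PiM {1..n} (\<lambda>_. borel))"
    by (intro measurable_PiM_single') (auto simp: PiE_def)
  show ?thesis
    unfolding simplex_borel_def
    using measurable_restrict_space1[OF *]
    by (rule measurable_restrict_space2[rotated]) (auto simp: space_restrict_space)
qed

lemma sets_simplex_lebesgue: "sets (simplex_lebesgue n) = sets (simplex_borel n)"
  by (simp add: simplex_lebesgue_def)

lemma space_simplex_lebesgue: "space (simplex_lebesgue n) = open_simplex n"
  by (auto simp: simplex_lebesgue_def simplex_borel_def space_restrict_space space_PiM open_simplex_def)

text \<open>
  A distribution on \<open>{1..n}\<close> as a vector; the restriction is needed since elements of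
  \<open>open_simplex n\<close> are \<open>undefined\<close> outside \<open>{1..n}\<close>.
\<close>

definition pmf_vector :: "nat \<Rightarrow> nat pmf \<Rightarrow> nat \<Rightarrow> real" where
  "pmf_vector n q = (\<lambda>z\<in>{1..n}. pmf q z)"

end

theory Submission
  imports Defs
begin

text \<open>
  For a stationary strategy, the probability that the target is not hit by period \<open>t + 1\<close> is
  \<open>(Q\<^sup>t 1)(s)\<close>, where \<open>Q\<close> is the positive matrix of transition probabilities between
  non-target states. Minimising the Collatz-Wielandt ratio over a compact set of positive vectors
  yields \<open>r > 0\<close> and \<open>v > 0\<close> solving the Bellman equation \<open>min\<^sub>a \<Sum>\<^sub>z p(z|s,a) v(z) = r v(s)\<close>.
  If every minimiser is unique, the pure strategy choosing it has survival probabilities of order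
  \<open>r\<^sup>t\<close>, whereas for any other stationary strategy \<open>Q v \<ge> r v\<close> is strict somewhere, so that
  its survival probabilities grow at least like \<open>r'\<^sup>t\<close> with \<open>r' > r\<close>.

  Uniqueness is generic: if \<open>b\<close> ties with the chosen action at \<open>s\<close>, then \<open>p(\<cdot>|s,b)\<close> lies on a
  hyperplane determined by the eigenvector of the chosen pure strategy, hence by transition
  distributions independent of \<open>p(\<cdot>|s,b)\<close>. Power iteration writes that eigenvector as a limit of
  ratios of survival probabilities, which makes it measurable, and Fubini's theorem gives
  probability zero.
\<close>

subsection \<open>Iterates of positive matrices\<close>

text \<open>The index \<open>t\<close> counts transitions, so the value concerns the states of
  periods 1 to \<open>t + 1\<close>. Keeping \<open>Q\<close> a plain function lets transition
  probabilities and coordinates of a product space be inserted alike.\<close>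

primrec survival :: "'s set \<Rightarrow> ('s \<Rightarrow> 's \<Rightarrow> real) \<Rightarrow> nat \<Rightarrow> 's \<Rightarrow> real" where
  "survival I Q 0 s = 1"
| "survival I Q (Suc t) s = (\<Sum>z\<in>I. Q s z * survival I Q t z)"

lemma survival_cong:
  assumes "\<And>s z. s \<in> I \<Longrightarrow> z \<in> I \<Longrightarrow> Q s z = Q' s z" "s \<in> I"
  shows "survival I Q t s = survival I Q' t s"
  using assms(2) by (induction t arbitrary: s) (auto intro!: sum.cong simp: assms(1))

lemma survival_nonneg:
  assumes "\<And>s z. Q s z \<ge> 0"
  shows "survival I Q t s \<ge> 0"
  by (induction t arbitrary: s) (auto intro!: sum_nonneg mult_nonneg_nonneg assms)

lemma survival_pos:
  assumes "finite I" "I \<noteq> {}" "\<And>s z. s \<in> I \<Longrightarrow> z \<in> I \<Longrightarrow> Q s z > 0" "s \<in> I"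
  shows "survival I Q t s > 0"
  using assms(4) by (induction t arbitrary: s) (auto intro!: sum_pos mult_pos_pos simp: assms)

text \<open>Each new value is an average of all old ones with weights at least \<open>e\<close>, the
  smallest entry of \<open>W\<close>. So the maximum over \<open>I\<close> decreases, the minimum
  increases, and their gap shrinks by the factor \<open>1 - e\<close> per step. The common limit is
  at least the initial minimum, hence positive.\<close>

lemma stochastic_iteration_tendsto:
  fixes W :: "'s \<Rightarrow> 's \<Rightarrow> real" and y :: "nat \<Rightarrow> 's \<Rightarrow> real"
  assumes fin: "finite I" and ne: "I \<noteq> {}"
    and pos: "\<And>s z. s \<in> I \<Longrightarrow> z \<in> I \<Longrightarrow> W s z > 0"
    and stoch: "\<And>s. s \<in> I \<Longrightarrow> (\<Sum>z\<in>I. W s z) = 1"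
    and step: "\<And>t s. s \<in> I \<Longrightarrow> y (Suc t) s = (\<Sum>z\<in>I. W s z * y t z)"
    and init: "\<And>s. s \<in> I \<Longrightarrow> y 0 s > 0"
  shows "\<exists>c>0. \<forall>s\<in>I. (\<lambda>t. y t s) \<longlonglongrightarrow> c"
proof -
  define e where "e = Min ((\<lambda>(s, z). W s z) ` (I \<times> I))"
  define u where "u t = Max (y t ` I)" for t
  define l where "l t = Min (y t ` I)" for t
  have e_le: "e \<le> W s z" if "s \<in> I" "z \<in> I" for s z
    unfolding e_def using that fin by (intro Min_le) force+
  have e_pos: "e > 0"
    unfolding e_def using fin ne pos by (subst Min_gr_iff) auto
  obtain s0 where s0: "s0 \<in> I" using ne by auto
  have "W s0 s0 \<le> (\<Sum>z\<in>I. W s0 z)"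
    using fin s0 by (intro member_le_sum) (auto intro: less_imp_le pos)
  then have e_le1: "e \<le> 1"
    using e_le[OF s0 s0] stoch[OF s0] by simp
  have y_le: "y t s \<le> u t" if "s \<in> I" for t s
    unfolding u_def using that fin by simp
  have y_ge: "l t \<le> y t s" if "s \<in> I" for t s
    unfolding l_def using that fin by simp
  \<comment> \<open>A state attaining the minimum \<open>l t\<close> has weight at least
    \<open>e\<close>, which pulls the average below \<open>u t\<close> by at least
    \<open>e * (u t - l t)\<close>.\<close>
  have upper: "y (Suc t) s \<le> u t - e * (u t - l t)" if s: "s \<in> I" for t s
  proof -
    have "l t \<in> y t ` I"
      unfolding l_def using fin ne by (intro Min_in) auto
    then obtain z where z: "z \<in> I" "y t z = l t" by auto
    have "e * (u t - l t) \<le> W s z * (u t - y t z)"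
      unfolding z(2)[symmetric] using e_le[OF s z(1)] y_le[OF z(1), of t]
      by (intro mult_right_mono) simp_all
    also have "\<dots> \<le> (\<Sum>z\<in>I. W s z * (u t - y t z))"
      using fin z(1)
      by (intro member_le_sum[of z I "\<lambda>z. W s z * (u t - y t z)"])
         (simp_all add: less_imp_le[OF pos[OF s]] y_le)
    also have "\<dots> = u t - y (Suc t) s"
      using stoch[OF s] by (simp add: step[OF s] right_diff_distrib sum_subtractf flip: sum_distrib_right)
    finally show ?thesis by simp
  qed
  have lower: "l t \<le> y (Suc t) s" if s: "s \<in> I" for t s
  proof -
    have "l t = (\<Sum>z\<in>I. W s z * l t)"
      using stoch[OF s] by (simp flip: sum_distrib_right)
    also have "\<dots> \<le> y (Suc t) s"
      unfolding step[OF s] using s y_ge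
      by (intro sum_mono mult_left_mono) (auto intro!: less_imp_le[OF pos])
    finally show ?thesis .
  qed
  have u_Suc: "u (Suc t) \<le> u t - e * (u t - l t)" for t
    unfolding u_def[of "Suc t"] using fin ne upper by (subst Max_le_iff) auto
  have l_Suc: "l t \<le> l (Suc t)" for t
    unfolding l_def[of "Suc t"] using fin ne lower by (subst Min_ge_iff) auto
  have l_le_u: "l t \<le> u t" for t
    using y_le[OF s0, of t] y_ge[OF s0, of t] by simp
  have gap: "u t - l t \<le> (1 - e) ^ t * (u 0 - l 0)" for t
  proof (induction t)
    case (Suc t)
    have "u (Suc t) - l (Suc t) \<le> (1 - e) * (u t - l t)"
      using u_Suc[of t] l_Suc[of t] by (simp add: algebra_simps)
    also have "\<dots> \<le> (1 - e) * ((1 - e) ^ t * (u 0 - l 0))"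
      using Suc e_le1 by (intro mult_left_mono) auto
    finally show ?case by simp
  qed simp
  have "(\<lambda>t. (1 - e) ^ t * (u 0 - l 0)) \<longlonglongrightarrow> 0"
    using e_pos e_le1 by (auto intro!: tendsto_mult_left_zero LIMSEQ_power_zero)
  then have gap_lim: "(\<lambda>t. u t - l t) \<longlonglongrightarrow> 0"
    by (rule tendsto_sandwich[OF _ _ tendsto_const, rotated 2]) (auto simp: l_le_u gap)
  have "incseq l"
    using l_Suc by (rule incseq_SucI)
  have "decseq u"
  proof (rule decseq_SucI)
    fix t
    have "0 \<le> e * (u t - l t)" using e_pos l_le_u by simp
    then show "u (Suc t) \<le> u t" using u_Suc[of t] by simp
  qed
  have "l t \<le> u 0" for t
    using l_le_u[of t] decseqD[OF \<open>decseq u\<close>, of 0 t] by simp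
  with \<open>incseq l\<close> obtain c where c: "l \<longlonglongrightarrow> c" "\<And>t. l t \<le> c"
    using incseq_convergent by blast
  have "0 < l 0"
    unfolding l_def using fin ne init by (subst Min_gr_iff) auto
  then have "0 < c" using c(2)[of 0] by simp
  have "u \<longlonglongrightarrow> c"
    using tendsto_add[OF gap_lim c(1)] by simp
  have "(\<lambda>t. y t s) \<longlonglongrightarrow> c" if "s \<in> I" for s
    by (rule tendsto_sandwich[OF _ _ c(1) \<open>u \<longlonglongrightarrow> c\<close>]) (simp_all add: y_le y_ge that)
  with \<open>0 < c\<close> show ?thesis by blast
qed

text \<open>Conjugating \<open>Q\<close> by the eigenvector and dividing by \<open>r\<close> gives a
  stochastic matrix \<open>W\<close> with positive entries (Doob's h-transform). The survival
  values, rescaled to \<open>y\<close>, evolve under \<open>W\<close> and so converge to a common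
  constant.\<close>

lemma survival_asymptotics:
  fixes Q :: "'s \<Rightarrow> 's \<Rightarrow> real"
  assumes fin: "finite I" and ne: "I \<noteq> {}"
    and pos: "\<And>s z. s \<in> I \<Longrightarrow> z \<in> I \<Longrightarrow> Q s z > 0"
    and v: "\<And>s. s \<in> I \<Longrightarrow> v s > 0"
    and r: "r > 0" and eig: "\<And>s. s \<in> I \<Longrightarrow> (\<Sum>z\<in>I. Q s z * v z) = r * v s"
  shows "\<exists>c>0. \<forall>s\<in>I. (\<lambda>t. survival I Q t s / r ^ t) \<longlonglongrightarrow> c * v s"
proof -
  define W where "W s z = Q s z * v z / (r * v s)" for s z
  define y where "y t s = survival I Q t s / (r ^ t * v s)" for t s
  have "\<exists>c>0. \<forall>s\<in>I. (\<lambda>t. y t s) \<longlonglongrightarrow> c"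
  proof (rule stochastic_iteration_tendsto[OF fin ne, of W])
    show "(\<Sum>z\<in>I. W s z) = 1" if "s \<in> I" for s
      using eig[OF that] v[OF that] r by (simp add: W_def flip: sum_divide_distrib)
    show "y (Suc t) s = (\<Sum>z\<in>I. W s z * y t z)" if "s \<in> I" for t s
      unfolding y_def W_def survival.simps sum_divide_distrib
    proof (rule sum.cong[OF refl])
      fix z assume "z \<in> I"
      then show "Q s z * survival I Q t z / (r ^ Suc t * v s) =
          Q s z * v z / (r * v s) * (survival I Q t z / (r ^ t * v z))"
        using v[of z] by (simp add: field_simps)
    qed
  qed (auto simp: W_def y_def v r pos)
  then obtain c where c: "c > 0" "\<And>s. s \<in> I \<Longrightarrow> (\<lambda>t. y t s) \<longlonglongrightarrow> c" by blast
  have "(\<lambda>t. survival I Q t s / r ^ t) \<longlonglongrightarrow> c * v s" if "s \<in> I" for s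
    using tendsto_mult_right[OF c(2)[OF that], of "v s"] v[OF that] by (simp add: y_def)
  with c(1) show ?thesis by blast
qed

text \<open>The factor \<open>c * r ^ t\<close> cancels. The eigenvector normalised at
  \<open>s\<close> is thus a limit of rational functions of the entries of \<open>Q\<close>, which
  later gives its measurability.\<close>

lemma survival_ratio_tendsto:
  fixes Q :: "'s \<Rightarrow> 's \<Rightarrow> real"
  assumes fin: "finite I"
    and pos: "\<And>s z. s \<in> I \<Longrightarrow> z \<in> I \<Longrightarrow> Q s z > 0"
    and v: "\<And>s. s \<in> I \<Longrightarrow> v s > 0"
    and r: "r > 0" and eig: "\<And>s. s \<in> I \<Longrightarrow> (\<Sum>z\<in>I. Q s z * v z) = r * v s"
    and z: "z \<in> I" and s: "s \<in> I"
  shows "(\<lambda>t. survival I Q t z / survival I Q t s) \<longlonglongrightarrow> v z / v s"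
proof -
  have "I \<noteq> {}" using s by auto
  from survival_asymptotics[OF fin this pos v r eig] obtain c where "c > 0"
    and c: "\<And>s. s \<in> I \<Longrightarrow> (\<lambda>t. survival I Q t s / r ^ t) \<longlonglongrightarrow> c * v s" by blast
  have "(\<lambda>t. (survival I Q t z / r ^ t) / (survival I Q t s / r ^ t)) \<longlonglongrightarrow> (c * v z) / (c * v s)"
    using c[OF z] c[OF s] v[OF s] \<open>c > 0\<close> by (intro tendsto_divide) auto
  with r \<open>c > 0\<close> show ?thesis by simp
qed

text \<open>Positivity of \<open>Q\<close> spreads the strict inequality from \<open>s0\<close> to
  all states: \<open>w = Q v\<close> satisfies \<open>Q w > r w\<close> everywhere. The smallest
  ratio \<open>r'\<close> of \<open>Q w\<close> to \<open>w\<close> therefore exceeds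
  \<open>r\<close>, and it bounds the growth of the iterates from below.\<close>

lemma survival_lower_bound:
  fixes Q :: "'s \<Rightarrow> 's \<Rightarrow> real"
  assumes fin: "finite I"
    and pos: "\<And>s z. s \<in> I \<Longrightarrow> z \<in> I \<Longrightarrow> Q s z > 0"
    and v: "\<And>s. s \<in> I \<Longrightarrow> v s > 0"
    and r: "r > 0" and super: "\<And>s. s \<in> I \<Longrightarrow> r * v s \<le> (\<Sum>z\<in>I. Q s z * v z)"
    and s0: "s0 \<in> I" "r * v s0 < (\<Sum>z\<in>I. Q s0 z * v z)"
  shows "\<exists>r'>r. \<exists>c>0. \<forall>t. \<forall>s\<in>I. c * r' ^ t \<le> survival I Q t s"
proof -
  define w where "w s = (\<Sum>z\<in>I. Q s z * v z)" for s
  define r' where "r' = Min ((\<lambda>s. (\<Sum>z\<in>I. Q s z * w z) / w s) ` I)"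
  have ne: "I \<noteq> {}" using s0 by auto
  have w_pos: "w s > 0" if "s \<in> I" for s
    unfolding w_def using fin ne that by (intro sum_pos) (auto intro!: mult_pos_pos pos v)
  have gain: "r * w s < (\<Sum>z\<in>I. Q s z * w z)" if s: "s \<in> I" for s
  proof -
    have "r * w s = (\<Sum>z\<in>I. Q s z * (r * v z))"
      by (simp add: w_def sum_distrib_left mult_ac)
    also have "\<dots> < (\<Sum>z\<in>I. Q s z * w z)"
      using s super s0 fin pos[OF s]
      by (intro sum_strict_mono_ex1 ballI bexI[of _ s0] mult_left_mono mult_strict_left_mono)
         (auto simp: w_def less_imp_le)
    finally show ?thesis .
  qed
  have "r < r'"
    unfolding r'_def using fin ne gain w_pos by (subst Min_gr_iff) (auto simp: pos_less_divide_eq)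
  have r'_le: "r' * w s \<le> (\<Sum>z\<in>I. Q s z * w z)" if "s \<in> I" for s
  proof -
    have "r' \<le> (\<Sum>z\<in>I. Q s z * w z) / w s"
      unfolding r'_def using fin that by (intro Min_le) auto
    then show ?thesis using w_pos[OF that] by (simp add: pos_le_divide_eq)
  qed
  have Max_w: "w s \<le> Max (w ` I)" if "s \<in> I" for s
    using fin that by simp
  have Max_pos: "Max (w ` I) > 0"
    using Max_w[OF s0(1)] w_pos[OF s0(1)] by simp
  \<comment> \<open>Divided by its maximum, \<open>w\<close> lies below the constant 1 that starts
    the iteration; monotonicity of \<open>Q\<close> carries the bound on.\<close>
  have iter: "r' ^ t * (w s / Max (w ` I)) \<le> survival I Q t s" if "s \<in> I" for t s
    using that
  proof (induction t arbitrary: s)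
    case 0
    then show ?case using Max_w Max_pos by simp
  next
    case (Suc t)
    have "r' ^ Suc t * (w s / Max (w ` I)) = r' ^ t / Max (w ` I) * (r' * w s)"
      by simp
    also have "\<dots> \<le> r' ^ t / Max (w ` I) * (\<Sum>z\<in>I. Q s z * w z)"
      using r'_le[OF Suc.prems] Max_pos \<open>r < r'\<close> r by (intro mult_left_mono) auto
    also have "\<dots> = (\<Sum>z\<in>I. Q s z * (r' ^ t * (w z / Max (w ` I))))"
      by (simp add: sum_distrib_left mult_ac)
    also have "\<dots> \<le> survival I Q (Suc t) s"
      unfolding survival.simps using Suc
      by (intro sum_mono mult_left_mono) (simp_all add: less_imp_le[OF pos])
    finally show ?case .
  qed
  define d where "d = Min (w ` I) / Max (w ` I)"
  have "d > 0"
    unfolding d_def using fin ne w_pos Max_pos by (intro divide_pos_pos) (subst Min_gr_iff, auto)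
  moreover have "d * r' ^ t \<le> survival I Q t s" if "s \<in> I" for t s
  proof -
    have "d \<le> w s / Max (w ` I)"
      unfolding d_def using fin that Max_pos by (intro divide_right_mono) auto
    then have "d * r' ^ t \<le> r' ^ t * (w s / Max (w ` I))"
      using r \<open>r < r'\<close> by (subst mult.commute, intro mult_left_mono) auto
    with iter[OF that, of t] show ?thesis by linarith
  qed
  ultimately show ?thesis using \<open>r < r'\<close> by blast
qed

subsection \<open>The Bellman eigenvector\<close>

lemma continuous_on_Max_image:
  fixes f :: "'b \<Rightarrow> 'c::topological_space \<Rightarrow> real"
  assumes "finite B" "B \<noteq> {}" "\<And>b. b \<in> B \<Longrightarrow> continuous_on K (f b)"
  shows "continuous_on K (\<lambda>x. Max ((\<lambda>b. f b x) ` B))"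
  using assms
proof (induction B rule: finite_ne_induct)
  case (insert b B)
  have "continuous_on K (\<lambda>x. max (f b x) (Max ((\<lambda>b. f b x) ` B)))"
    using insert by (intro continuous_on_max) auto
  with insert show ?case by simp
qed simp

lemma continuous_on_Min_image:
  fixes f :: "'b \<Rightarrow> 'c::topological_space \<Rightarrow> real"
  assumes "finite B" "B \<noteq> {}" "\<And>b. b \<in> B \<Longrightarrow> continuous_on K (f b)"
  shows "continuous_on K (\<lambda>x. Min ((\<lambda>b. f b x) ` B))"
  using assms
proof (induction B rule: finite_ne_induct)
  case (insert b B)
  have "continuous_on K (\<lambda>x. min (f b x) (Min ((\<lambda>b. f b x) ` B)))"
    using insert by (intro continuous_on_min) auto
  with insert show ?case by simp
qed simp

text \<open>Tychonoff's theorem, moved from the abstract product topology to the type class topology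
  on functions.\<close>

lemma compact_Pi_UNIV:
  fixes K :: "'i \<Rightarrow> 'b::topological_space set"
  assumes "\<And>i. compact (K i)"
  shows "compact (Pi UNIV K)"
proof -
  have "compactin (product_topology (\<lambda>_. euclidean) UNIV) (PiE UNIV K)"
    using assms by (simp add: compactin_PiE)
  then show ?thesis
    by (simp add: euclidean_product_topology PiE_UNIV_domain Pi_def)
qed

text \<open>A nonlinear Perron-Frobenius argument. Let \<open>v\<close> minimise the largest ratio
  \<open>T v s / v s\<close>, with minimum \<open>r\<close>; then \<open>T v \<le> r v\<close>. If
  this were strict at one state, strict monotonicity would give \<open>T (T v) < r T v\<close> at
  all states, so a multiple of \<open>T v\<close> would do better than \<open>v\<close>.\<close>

lemma bellman_eigenvector:
  fixes P :: "'s \<Rightarrow> 'a \<Rightarrow> 's \<Rightarrow> real"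
  assumes fin: "finite I" and ne: "I \<noteq> {}"
    and A: "\<And>s. s \<in> I \<Longrightarrow> finite (A s)" "\<And>s. s \<in> I \<Longrightarrow> A s \<noteq> {}"
    and pos: "\<And>s a z. s \<in> I \<Longrightarrow> a \<in> A s \<Longrightarrow> z \<in> I \<Longrightarrow> P s a z > 0"
  shows "\<exists>r>0. \<exists>v. (\<forall>s\<in>I. v s > 0) \<and>
           (\<forall>s\<in>I. Min ((\<lambda>a. \<Sum>z\<in>I. P s a z * v z) ` A s) = r * v s)"
proof -
  define T where "T v s = Min ((\<lambda>a. \<Sum>z\<in>I. P s a z * v z) ` A s)" for v s
  define E where "E = (\<lambda>(s, a, z). P s a z) ` (SIGMA s:I. A s \<times> I)"
  define e where "e = Min E"
  define B where "B = Max E"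
  have "finite E"
    unfolding E_def using fin A by (intro finite_imageI finite_SigmaI finite_cartesian_product) auto
  moreover have "E \<noteq> {}"
    unfolding E_def using ne A(2) by fastforce
  ultimately have e_pos: "e > 0"
    unfolding e_def by (subst Min_gr_iff) (auto simp: E_def pos)
  have P_in: "P s a z \<in> E" if "s \<in> I" "a \<in> A s" "z \<in> I" for s a z
    unfolding E_def using that by force
  have e_le: "e \<le> P s a z" and le_B: "P s a z \<le> B" if "s \<in> I" "a \<in> A s" "z \<in> I" for s a z
    unfolding e_def B_def using P_in[OF that] \<open>finite E\<close> by auto
  have T_le: "T v s \<le> (\<Sum>z\<in>I. P s a z * v z)" if "s \<in> I" "a \<in> A s" for v s a
    unfolding T_def using A that by (intro Min_le) auto
  have T_attained: "\<exists>a\<in>A s. T v s = (\<Sum>z\<in>I. P s a z * v z)" if "s \<in> I" for v s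
  proof -
    have "T v s \<in> (\<lambda>a. \<Sum>z\<in>I. P s a z * v z) ` A s"
      unfolding T_def using A that by (intro Min_in) auto
    then show ?thesis by auto
  qed
  have T_pos: "T v s > 0" if "\<And>z. z \<in> I \<Longrightarrow> v z > 0" "s \<in> I" for v s
    using T_attained[OF that(2), of v] fin ne that
    by (auto intro!: sum_pos mult_pos_pos pos)
  have T_scale: "T (\<lambda>z. k * v z) s = k * T v s" if "k > 0" and s: "s \<in> I" for k v s
  proof -
    obtain a where a: "a \<in> A s" "T v s = (\<Sum>z\<in>I. P s a z * v z)"
      using T_attained[OF s] by blast
    obtain b where b: "b \<in> A s" "T (\<lambda>z. k * v z) s = (\<Sum>z\<in>I. P s b z * (k * v z))"
      using T_attained[OF s] by blast
    have *: "(\<Sum>z\<in>I. P s a z * (k * v z)) = k * (\<Sum>z\<in>I. P s a z * v z)" for a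
      by (simp add: sum_distrib_left mult_ac)
    have "T (\<lambda>z. k * v z) s \<le> k * T v s"
      using T_le[OF s a(1), of "\<lambda>z. k * v z"] a(2) * by simp
    moreover have "k * T v s \<le> T (\<lambda>z. k * v z) s"
      using T_le[OF s b(1), of v] b(2) * \<open>k > 0\<close> by simp
    ultimately show ?thesis by simp
  qed
  \<comment> \<open>The action optimal for \<open>w\<close> is evaluated at both vectors; all its
    weights are positive, so an increase in one coordinate is felt at every state.\<close>
  have T_strict: "T v s < T w s"
    if "\<And>z. z \<in> I \<Longrightarrow> v z \<le> w z" "z0 \<in> I" "v z0 < w z0" and s: "s \<in> I" for v w s z0
  proof -
    obtain a where a: "a \<in> A s" "T w s = (\<Sum>z\<in>I. P s a z * w z)"
      using T_attained[OF s] by blast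
    have "T v s \<le> (\<Sum>z\<in>I. P s a z * v z)"
      using T_le a that by blast
    also have "\<dots> < (\<Sum>z\<in>I. P s a z * w z)"
      using fin that pos[OF s a(1)]
      by (intro sum_strict_mono_ex1 ballI bexI[of _ z0] mult_left_mono mult_strict_left_mono)
         (auto simp: less_imp_le)
    finally show ?thesis using a by simp
  qed
  \<comment> \<open>The bounds \<open>e\<close> and \<open>B\<close> are the extreme entries of
    \<open>P\<close>: \<open>T\<close> maps positive vectors of total mass 1 on \<open>I\<close>
    into this box. Coordinates outside \<open>I\<close> are frozen at 0 to keep the set compact in
    the full function space.\<close>
  define K where "K = Pi UNIV (\<lambda>i. if i \<in> I then {e..B} else {0::real})"
  define F where "F v = Max ((\<lambda>s. T v s / v s) ` I)" for v
  have K_pos: "v s > 0" if "v \<in> K" "s \<in> I" for v s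
  proof -
    have "v s \<in> {e..B}" using that by (auto simp: K_def Pi_def split: if_splits)
    then show ?thesis using e_pos by simp
  qed
  have "compact K"
    unfolding K_def by (intro compact_Pi_UNIV) auto
  moreover have "K \<noteq> {}"
  proof -
    have "e \<le> B" using ne A(2) e_le le_B by (meson all_not_in_conv order_trans)
    then have "(\<lambda>s. if s \<in> I then e else 0) \<in> K" by (auto simp: K_def)
    then show ?thesis by blast
  qed
  moreover have "continuous_on K F"
  proof -
    have coord: "continuous_on K (\<lambda>v. v i)" for i
      by (rule continuous_on_product_then_coordinatewise) (rule continuous_on_id)
    show ?thesis
      unfolding F_def T_def using fin ne A K_pos
      by (intro continuous_on_Max_image continuous_on_divide continuous_on_Min_image
            continuous_on_sum continuous_on_mult continuous_on_const coord)
         (auto simp: less_imp_neq[THEN not_sym])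
  qed
  ultimately obtain v where v: "v \<in> K" "\<And>w. w \<in> K \<Longrightarrow> F v \<le> F w"
    using continuous_attains_inf[of K F] by auto
  define r where "r = F v"
  have v_pos: "v s > 0" if "s \<in> I" for s
    using K_pos v(1) that by blast
  have T_le_r: "T v s \<le> r * v s" if "s \<in> I" for s
  proof -
    have "T v s / v s \<le> r"
      unfolding r_def F_def using fin that by (intro Max_ge) auto
    then show ?thesis using v_pos[OF that] by (simp add: pos_divide_le_eq)
  qed
  have Tv_pos: "T v s > 0" if "s \<in> I" for s
    using v_pos that by (rule T_pos)
  obtain s1 where s1: "s1 \<in> I" using ne by auto
  have "0 < r * v s1"
    using T_le_r[OF s1] Tv_pos[OF s1] by simp
  then have "r > 0"
    using v_pos[OF s1] by (simp add: zero_less_mult_iff)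
  have "T v s = r * v s" if "s \<in> I" for s
  proof (rule ccontr)
    \<comment> \<open>Otherwise one more application of \<open>T\<close>, rescaled into \<open>K\<close>, has a strictly smaller maximal ratio.\<close>
    assume "T v s \<noteq> r * v s"
    with T_le_r[OF that] have strict: "T v s < r * v s" by simp
    \<comment> \<open>This scales \<open>v\<close> to total mass 1 on \<open>I\<close>, which is
      what puts \<open>w\<close> back into \<open>K\<close>.\<close>
    define k where "k = 1 / (\<Sum>z\<in>I. v z)"
    define w where "w s = (if s \<in> I then k * T v s else 0)" for s
    have "(\<Sum>z\<in>I. v z) > 0"
      using fin ne v_pos by (intro sum_pos) auto
    then have k: "k > 0" by (simp add: k_def)
    have "w \<in> K"
    proof -
      have "k * T v s \<in> {e..B}" if s: "s \<in> I" for s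
      proof -
        obtain a where a: "a \<in> A s" "T v s = (\<Sum>z\<in>I. P s a z * v z)"
          using T_attained[OF s] by blast
        have "e * (\<Sum>z\<in>I. v z) \<le> T v s"
          unfolding a(2) sum_distrib_left using s a(1) e_le v_pos
          by (intro sum_mono mult_right_mono) (auto simp: less_imp_le)
        moreover have "T v s \<le> B * (\<Sum>z\<in>I. v z)"
          unfolding a(2) sum_distrib_left using s a(1) le_B v_pos
          by (intro sum_mono mult_right_mono) (auto simp: less_imp_le)
        ultimately show ?thesis
          using \<open>(\<Sum>z\<in>I. v z) > 0\<close> by (simp add: k_def field_simps)
      qed
      then show ?thesis by (auto simp: K_def w_def)
    qed
    have T_w: "T w s = k * T (T v) s" if "s \<in> I" for s
    proof -
      have "T w s = T (\<lambda>z. k * T v z) s"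
        unfolding T_def w_def by simp
      also have "\<dots> = k * T (T v) s"
        using T_scale[OF k that] by simp
      finally show ?thesis .
    qed
    have "T w s' / w s' < r" if s': "s' \<in> I" for s'
    proof -
      have "T (T v) s' < T (\<lambda>z. r * v z) s'"
        using T_le_r strict \<open>s \<in> I\<close> s' by (intro T_strict[of _ _ s]) auto
      also have "\<dots> = r * T v s'"
        using T_scale[OF \<open>r > 0\<close> s'] by simp
      finally show ?thesis
        using T_w[OF s'] s' k Tv_pos[OF s'] by (simp add: w_def pos_divide_less_eq)
    qed
    then have "F w < r"
      unfolding F_def using fin ne by (subst Max_less_iff) auto
    with v(2)[OF \<open>w \<in> K\<close>] show False by (simp add: r_def)
  qed
  with \<open>r > 0\<close> v_pos show ?thesis
    unfolding T_def by blast
qed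

section \<open>Unique Bellman minimisers and strict dominance\<close>

text \<open>\<open>f\<close> selects a Bellman minimiser at each state, and \<open>generic\<close>
  excludes any other. A differing \<open>g\<close> then gains strictly somewhere, so its survival
  values outgrow \<open>r ^ t\<close>. The hypothesis \<open>generic\<close> ranges over all
  selections and speaks of limits of ratios because \<open>r\<close>, \<open>v\<close> and
  \<open>f\<close> are found only inside the proof.\<close>

lemma optimal_selection:
  fixes P :: "'s \<Rightarrow> 'a \<Rightarrow> 's \<Rightarrow> real"
  assumes fin: "finite I" and s0: "s0 \<in> I"
    and A: "\<And>s. s \<in> I \<Longrightarrow> finite (A s)" "\<And>s. s \<in> I \<Longrightarrow> A s \<noteq> {}"
    and pos: "\<And>s a z. s \<in> I \<Longrightarrow> a \<in> A s \<Longrightarrow> z \<in> I \<Longrightarrow> P s a z > 0"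
    and generic: "\<And>f s b. f \<in> PiE I A \<Longrightarrow> s \<in> I \<Longrightarrow> b \<in> A s \<Longrightarrow> b \<noteq> f s \<Longrightarrow>
      (\<Sum>z\<in>I. (P s b z - P s (f s) z) *
         lim (\<lambda>t. survival I (\<lambda>s. P s (f s)) t z / survival I (\<lambda>s. P s (f s)) t s0)) \<noteq> 0"
  shows "\<exists>f\<in>PiE I A. \<forall>g :: 's \<Rightarrow> 'a pmf.
      (\<forall>s\<in>I. set_pmf (g s) \<subseteq> A s) \<and> (\<exists>s\<in>I. g s \<noteq> return_pmf (f s)) \<longrightarrow>
      (\<forall>\<^sub>F t in sequentially. \<forall>s\<in>I. survival I (\<lambda>s. P s (f s)) t s
         < survival I (\<lambda>s z. \<Sum>a\<in>A s. pmf (g s) a * P s a z) t s)"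
proof -
  have ne: "I \<noteq> {}" using s0 by auto
  obtain r v where r: "r > 0" and v: "\<And>s. s \<in> I \<Longrightarrow> v s > 0"
    and bellman: "\<And>s. s \<in> I \<Longrightarrow> Min ((\<lambda>a. \<Sum>z\<in>I. P s a z * v z) ` A s) = r * v s"
  proof -
    have "\<exists>r>0. \<exists>v. (\<forall>s\<in>I. v s > 0) \<and>
        (\<forall>s\<in>I. Min ((\<lambda>a. \<Sum>z\<in>I. P s a z * v z) ` A s) = r * v s)"
      by (rule bellman_eigenvector) (simp_all add: fin ne A pos)
    with that show thesis by blast
  qed
  define h where "h s a = (\<Sum>z\<in>I. P s a z * v z)" for s a
  have "\<exists>a\<in>A s. h s a = r * v s" if "s \<in> I" for s
  proof -
    have "Min (h s ` A s) \<in> h s ` A s"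
      using A that by (intro Min_in) auto
    then show ?thesis using bellman[OF that] by (auto simp: h_def)
  qed
  then obtain f' where f': "\<And>s. s \<in> I \<Longrightarrow> f' s \<in> A s" "\<And>s. s \<in> I \<Longrightarrow> h s (f' s) = r * v s"
    by metis
  \<comment> \<open>The restriction makes the selection a member of the finite set
    \<open>PiE I A\<close>.\<close>
  define f where "f = restrict f' I"
  have f: "f \<in> PiE I A" "\<And>s. s \<in> I \<Longrightarrow> f s \<in> A s" "\<And>s. s \<in> I \<Longrightarrow> h s (f s) = r * v s"
    using f' by (auto simp: f_def)
  let ?F = "survival I (\<lambda>s. P s (f s))"
  have F_pos: "P s (f s) z > 0" if "s \<in> I" "z \<in> I" for s z
    using pos f(2) that by blast
  have F_eig: "(\<Sum>z\<in>I. P s (f s) z * v z) = r * v s" if "s \<in> I" for s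
    using f(3)[OF that] by (simp add: h_def)
  have h_ge: "r * v s \<le> h s a" if "s \<in> I" "a \<in> A s" for s a
  proof -
    have "Min (h s ` A s) \<le> h s a" using A that by (intro Min_le) auto
    then show ?thesis using bellman[OF that(1)] by (simp add: h_def)
  qed
  \<comment> \<open>A tie makes the difference of the two transition rows orthogonal to
    \<open>v\<close>, hence to the limit of the survival ratios, which is \<open>v\<close> divided
    by \<open>v s0\<close>.\<close>
  have h_neq: "h s b \<noteq> r * v s" if s: "s \<in> I" and b: "b \<in> A s" "b \<noteq> f s" for s b
  proof
    assume eq: "h s b = r * v s"
    have lim_eq: "lim (\<lambda>t. ?F t z / ?F t s0) = v z / v s0" if "z \<in> I" for z
      by (intro limI survival_ratio_tendsto[where r = r]) (simp_all add: fin F_pos v r F_eig that s0)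
    have "(\<Sum>z\<in>I. (P s b z - P s (f s) z) * lim (\<lambda>t. ?F t z / ?F t s0)) =
        (\<Sum>z\<in>I. (P s b z - P s (f s) z) * v z) / v s0"
      by (simp add: lim_eq sum_divide_distrib)
    also have "\<dots> = (h s b - h s (f s)) / v s0"
      by (simp add: h_def left_diff_distrib sum_subtractf)
    also have "\<dots> = 0" using eq f(3)[OF s] by simp
    finally show False using generic[OF f(1) s b] by simp
  qed
  have "\<forall>\<^sub>F t in sequentially. \<forall>s\<in>I. ?F t s
         < survival I (\<lambda>s z. \<Sum>a\<in>A s. pmf (g s) a * P s a z) t s"
    if g: "\<And>s. s \<in> I \<Longrightarrow> set_pmf (g s) \<subseteq> A s" and s1: "s1 \<in> I" "g s1 \<noteq> return_pmf (f s1)"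
    for g :: "'s \<Rightarrow> 'a pmf" and s1
  proof -
    let ?G = "\<lambda>s z. \<Sum>a\<in>A s. pmf (g s) a * P s a z"
    have G_pos: "?G s z > 0" if s: "s \<in> I" and z: "z \<in> I" for s z
    proof -
      obtain a where a: "a \<in> set_pmf (g s)" using set_pmf_not_empty by fast
      have "pmf (g s) a * P s a z > 0"
        using a g[OF s] pos[OF s _ z] by (intro mult_pos_pos pmf_positive) auto
      then show ?thesis
        using A(1)[OF s] a g[OF s] pos[OF s _ z]
        by (intro sum_pos2[of "A s" a]) (auto intro!: mult_nonneg_nonneg simp: less_imp_le)
    qed
    \<comment> \<open>Randomising averages the action values \<open>h s a\<close>, each of which is
      at least \<open>r * v s\<close>.\<close>
    have G_eq: "(\<Sum>z\<in>I. ?G s z * v z) = (\<Sum>a\<in>A s. pmf (g s) a * h s a)" for s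
      unfolding h_def sum_distrib_left sum_distrib_right
      by (subst sum.swap) (simp add: mult_ac)
    have const_eq: "r * v s = (\<Sum>a\<in>A s. pmf (g s) a * (r * v s))" if "s \<in> I" for s
      using sum_pmf_eq_1[OF A(1)[OF that] g[OF that]] by (simp flip: sum_distrib_right)
    have super: "r * v s \<le> (\<Sum>z\<in>I. ?G s z * v z)" if "s \<in> I" for s
      unfolding G_eq by (subst const_eq[OF that]) (intro sum_mono mult_left_mono h_ge[OF that], simp_all)
    \<comment> \<open>A law other than the point mass at \<open>f s1\<close> charges a further
      action \<open>b\<close>, whose value lies strictly above the minimum.\<close>
    have "\<not> set_pmf (g s1) \<subseteq> {f s1}"
      using s1(2) by (simp add: set_pmf_subset_singleton)
    then obtain b where b: "b \<in> set_pmf (g s1)" "b \<noteq> f s1" by auto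
    have "b \<in> A s1" using b(1) g[OF s1(1)] by auto
    then have "r * v s1 < h s1 b"
      using h_ge[OF s1(1), of b] h_neq[OF s1(1) _ b(2)] by simp
    then have "pmf (g s1) b * (r * v s1) < pmf (g s1) b * h s1 b"
      using b(1) by (intro mult_strict_left_mono pmf_positive) auto
    then have strict: "r * v s1 < (\<Sum>z\<in>I. ?G s1 z * v z)"
      unfolding G_eq
      by (subst const_eq[OF s1(1)])
         (intro sum_strict_mono_ex1 A(1) s1(1) ballI mult_left_mono h_ge bexI[OF _ \<open>b \<in> A s1\<close>];
          simp)
    obtain r' c where r': "r' > r" and c: "c > 0"
      and lower: "\<And>t s. s \<in> I \<Longrightarrow> c * r' ^ t \<le> survival I ?G t s"
    proof -
      have "\<exists>r'>r. \<exists>c>0. \<forall>t. \<forall>s\<in>I. c * r' ^ t \<le> survival I ?G t s"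
        by (rule survival_lower_bound[where v = v and ?s0.0 = s1])
           (use fin G_pos v r super s1(1) strict in blast)+
      with that show thesis by blast
    qed
    obtain d where d: "\<And>s. s \<in> I \<Longrightarrow> (\<lambda>t. ?F t s / r ^ t) \<longlonglongrightarrow> d * v s"
    proof -
      have "\<exists>c>0. \<forall>s\<in>I. (\<lambda>t. ?F t s / r ^ t) \<longlonglongrightarrow> c * v s"
        by (rule survival_asymptotics) (simp_all add: fin ne F_pos v r F_eig)
      with that show thesis by blast
    qed
    have "\<forall>\<^sub>F t in sequentially. ?F t s < survival I ?G t s" if s: "s \<in> I" for s
    proof -
      \<comment> \<open>After division by \<open>r ^ t\<close> the values of \<open>f\<close> stay
        bounded, while those of \<open>g\<close> grow at least like
        \<open>(r' / r) ^ t\<close>.\<close>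
      have "LIM t sequentially. c * (r' / r) ^ t :> at_top"
        using r' r c
        by (intro filterlim_tendsto_pos_mult_at_top[OF tendsto_const]
              filterlim_at_infinity_imp_filterlim_at_top filterlim_realpow_sequentially_gt1) auto
      then have "\<forall>\<^sub>F t in sequentially. d * v s + 1 < c * (r' / r) ^ t"
        by (simp add: filterlim_at_top_dense)
      moreover have "\<forall>\<^sub>F t in sequentially. ?F t s / r ^ t < d * v s + 1"
        by (rule order_tendstoD(2)[OF d[OF s]]) simp
      ultimately show ?thesis
      proof eventually_elim
        case (elim t)
        then have "?F t s / r ^ t < c * r' ^ t / r ^ t"
          by (simp add: power_divide)
        then have "?F t s < c * r' ^ t"
          using r by (simp add: divide_less_cancel)
        with lower[OF s, of t] show ?case by simp
      qed
    qed
    then show ?thesis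
      using fin by (intro eventually_ball_finite) auto
  qed
  then show ?thesis using f(1) by blast
qed

subsection \<open>Reaching probabilities of stationary strategies\<close>

text \<open>Index \<open>i\<close> of a history stores period \<open>i + 1\<close>, and the infimum
  of a nonempty set of extended naturals is attained.\<close>

lemma hitting_period_le_iff:
  "hitting_period target h \<le> enat (Suc t) \<longleftrightarrow> (\<exists>i\<le>t. fst (h i) = target)"
proof
  let ?B = "{enat k | k. 1 \<le> k \<and> state_at h k = target}"
  assume le: "hitting_period target h \<le> enat (Suc t)"
  then have "?B \<noteq> {}"
  proof (intro notI)
    assume "?B = {}"
    then have "hitting_period target h = top"
      unfolding hitting_period_def by (simp only: Inf_empty)
    with le show False by (simp add: top_enat_def)
  qed
  then have "Inf ?B \<in> ?B"
    using wellorder_InfI by (metis (no_types, lifting) ex_in_conv)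
  then obtain k where k: "Inf ?B = enat k" "1 \<le> k" "state_at h k = target" by auto
  with le have "k - 1 \<le> t" by (simp add: hitting_period_def)
  then show "\<exists>i\<le>t. fst (h i) = target"
    using k(3) by (auto simp: state_at_def)
next
  assume "\<exists>i\<le>t. fst (h i) = target"
  then obtain i where i: "i \<le> t" "fst (h i) = target" by blast
  have "hitting_period target h \<le> enat (Suc i)"
    unfolding hitting_period_def using i by (intro Inf_lower) (auto simp: state_at_def)
  also have "\<dots> \<le> enat (Suc t)" using i by simp
  finally show "hitting_period target h \<le> enat (Suc t)" .
qed

text \<open>Probability that, after an arbitrary period with the given state and action, the next \<open>k\<close>
  states all differ from the target.\<close>

primrec avoid_prob ::
  "('s \<Rightarrow> 'a \<Rightarrow> 's pmf) \<Rightarrow> 's \<Rightarrow> ('s \<Rightarrow> 'a pmf) \<Rightarrow> nat \<Rightarrow> 's \<times> 'a \<Rightarrow> ennreal" where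
  "avoid_prob p target \<sigma> 0 x = 1"
| "avoid_prob p target \<sigma> (Suc k) x =
     (\<integral>\<^sup>+z. indicator (- {target}) z * (\<integral>\<^sup>+a. avoid_prob p target \<sigma> k (z, a) \<partial>\<sigma> z) \<partial>p (fst x) (snd x))"

lemma nn_integral_history_kernel_0:
  "(\<integral>\<^sup>+x. g x \<partial>history_kernel p \<sigma> s 0 h) = (\<integral>\<^sup>+a. g (s, a) \<partial>\<sigma> s)"
  by (simp add: history_kernel_def nn_integral_bind_pmf bind_return_pmf)

lemma nn_integral_history_kernel_Suc:
  "(\<integral>\<^sup>+x. g x \<partial>history_kernel p \<sigma> s (Suc i) h) =
     (\<integral>\<^sup>+z. (\<integral>\<^sup>+a. g (z, a) \<partial>\<sigma> z) \<partial>p (fst (h i)) (snd (h i)))"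
  by (simp add: history_kernel_def nn_integral_bind_pmf case_prod_beta)

text \<open>The event depends on the first \<open>t + 1\<close> coordinates only, whose law is a
  finite composition of kernels. Integrating these coordinates out from the last to the first
  unfolds \<open>avoid_prob\<close> one step at a time.\<close>

lemma emeasure_history_avoids:
  assumes "s \<noteq> target"
  shows "emeasure (history_measure p \<sigma> s)
           {h \<in> space (history_measure p \<sigma> s). \<forall>i\<le>t. fst (h i) \<noteq> target} =
         (\<integral>\<^sup>+a. avoid_prob p target \<sigma> t (s, a) \<partial>\<sigma> s)"
proof -
  let ?M = "\<lambda>_::nat. count_space (UNIV :: ('a \<times> 'b) set)"
  interpret Ionescu_Tulcea "history_kernel p \<sigma> s" ?M
    by (rule Ionescu_Tulcea_history_kernel)
  let ?C = "\<lambda>m. C 0 m (\<lambda>_. undefined)"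
  let ?av = "\<lambda>m (h :: nat \<Rightarrow> 'a \<times> 'b). \<Prod>i\<le>m. indicator (- {target}) (fst (h i)) :: ennreal"
  \<comment> \<open>The indices up to \<open>m\<close> are tested explicitly and the next
    \<open>k\<close> ones through \<open>avoid_prob\<close>; \<open>?C (Suc m)\<close> is the law of
    the coordinates 0 to \<open>m\<close>.\<close>
  define J where "J m k = (\<integral>\<^sup>+h. ?av m h * avoid_prob p target \<sigma> k (h m) \<partial>?C (Suc m))" for m k
  have start: "(\<lambda>_. undefined) \<in> space (PiM {0..<0::nat} ?M)"
    by simp
  have coord: "(\<lambda>h. g (h i)) \<in> borel_measurable (PiM {0..<m} ?M)" if "i < m"
    for g :: "'a \<times> 'b \<Rightarrow> ennreal" and i m
    using that by (intro measurable_compose[OF measurable_component_singleton]) auto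
  have meas: "(\<lambda>h. ?av m h * avoid_prob p target \<sigma> k (h m)) \<in> borel_measurable (PiM {0..<Suc m} ?M)"
    for m k
    by (intro borel_measurable_times_ennreal borel_measurable_prod_ennreal coord
          coord[where g = "\<lambda>x. indicator (- {target}) (fst x)"]) auto
  have J_0: "J 0 k = (\<integral>\<^sup>+a. avoid_prob p target \<sigma> k (s, a) \<partial>\<sigma> s)" for k
  proof -
    have "J 0 k = (\<integral>\<^sup>+h. ?av 0 h * avoid_prob p target \<sigma> k (h 0) \<partial>eP 0 (\<lambda>_. undefined))"
      unfolding J_def C.simps add_0 using start by (subst bind_return[OF measurable_eP]) auto
    also have "\<dots> = (\<integral>\<^sup>+x. indicator (- {target}) (fst x) * avoid_prob p target \<sigma> k x
        \<partial>history_kernel p \<sigma> s 0 (\<lambda>_. undefined))"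
      using meas[of 0 k] by (subst nn_integral_eP) auto
    also have "\<dots> = (\<integral>\<^sup>+a. avoid_prob p target \<sigma> k (s, a) \<partial>\<sigma> s)"
      using assms by (simp add: nn_integral_history_kernel_0)
    finally show ?thesis .
  qed
  have J_Suc: "J (Suc m) k = J m (Suc k)" for m k
  proof -
    have "J (Suc m) k = (\<integral>\<^sup>+h. (\<integral>\<^sup>+h'. ?av (Suc m) h' * avoid_prob p target \<sigma> k (h' (Suc m))
        \<partial>eP (Suc m) h) \<partial>?C (Suc m))"
      unfolding J_def
      by (subst C.simps(2), subst nn_integral_bind[where B = "PiM {0..<Suc (Suc m)} ?M"])
         (use meas[of "Suc m" k] start in \<open>auto simp del: C.simps prod.atMost_Suc
            simp: measurable_cong_sets[OF sets_C refl] measurable_eP\<close>)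
    also have "\<dots> = J m (Suc k)"
      unfolding J_def
    proof (intro nn_integral_cong)
      fix h assume "h \<in> space (?C (Suc m))"
      then have h: "h \<in> space (PiM {0..<Suc m} ?M)"
        using space_C[OF start, of "Suc m"] by (simp del: C.simps)
      have "(\<integral>\<^sup>+h'. ?av (Suc m) h' * avoid_prob p target \<sigma> k (h' (Suc m)) \<partial>eP (Suc m) h) =
          (\<integral>\<^sup>+x. ?av m h * (indicator (- {target}) (fst x) * avoid_prob p target \<sigma> k x)
            \<partial>history_kernel p \<sigma> s (Suc m) h)"
        using h meas[of "Suc m" k] by (subst nn_integral_eP) (auto simp: mult_ac)
      also have "\<dots> = ?av m h * (\<integral>\<^sup>+x. (indicator (- {target}) (fst x) * avoid_prob p target \<sigma> k x)
            \<partial>history_kernel p \<sigma> s (Suc m) h)"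
        by (rule nn_integral_cmult) (simp add: history_kernel_def)
      also have "\<dots> = ?av m h * avoid_prob p target \<sigma> (Suc k) (h m)"
        by (simp add: nn_integral_history_kernel_Suc nn_integral_cmult)
      finally show "(\<integral>\<^sup>+h'. ?av (Suc m) h' * avoid_prob p target \<sigma> k (h' (Suc m)) \<partial>eP (Suc m) h) =
        ?av m h * avoid_prob p target \<sigma> (Suc k) (h m)" .
    qed
    finally show ?thesis .
  qed
  have J: "J m k = (\<integral>\<^sup>+a. avoid_prob p target \<sigma> (m + k) (s, a) \<partial>\<sigma> s)" for m k
    by (induction m arbitrary: k) (simp_all only: J_0 J_Suc add_0 add_Suc add_Suc_right)
  define X where "X = {h \<in> space (PiM {0..<Suc t} ?M). \<forall>i\<le>t. fst (h i) \<noteq> target}"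
  have av_X: "?av t h * avoid_prob p target \<sigma> 0 (h t) = indicator X h"
    if "h \<in> space (PiM {0..<Suc t} ?M)" for h
  proof (cases "h \<in> X")
    case True
    then show ?thesis by (auto simp: X_def intro!: prod.neutral)
  next
    case False
    with that obtain i where "i \<le> t" "fst (h i) = target" by (auto simp: X_def)
    then have "?av t h = 0" by (intro prod_zero bexI[of _ i]) auto
    with False show ?thesis by simp
  qed
  \<comment> \<open>Measurability of \<open>X\<close> is read off from its indicator, which is a
    product of measurable factors.\<close>
  have "(indicator X :: _ \<Rightarrow> ennreal) \<in> borel_measurable (PiM {0..<Suc t} ?M)"
    by (rule measurable_cong[THEN iffD2, OF _ meas[of t 0]]) (simp only: av_X)
  then have "X \<inter> space (PiM {0..<Suc t} ?M) \<in> sets (PiM {0..<Suc t} ?M)"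
    by (rule borel_measurable_indicator_iff[THEN iffD1])
  moreover have "X \<inter> space (PiM {0..<Suc t} ?M) = X"
    unfolding X_def by blast
  ultimately have X: "X \<in> sets (PiM {0..<Suc t} ?M)"
    by simp
  have "{h \<in> space (history_measure p \<sigma> s). \<forall>i\<le>t. fst (h i) \<noteq> target} = PF.emb UNIV {0..<Suc t} X"
    by (auto simp: X_def prod_emb_def history_measure_def space_PiM PF.space_lim)
  then have "emeasure (history_measure p \<sigma> s)
           {h \<in> space (history_measure p \<sigma> s). \<forall>i\<le>t. fst (h i) \<noteq> target} = CI {0..<Suc t} X"
    unfolding history_measure_def using lim[OF _ X] by simp
  also have "\<dots> = ?C (Suc t) (PF.emb {0..<Suc t} {0..<Suc t} X)"
    using X by (intro emeasure_CI) auto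
  also have "PF.emb {0..<Suc t} {0..<Suc t} X = X"
    by (intro prod_emb_id) (auto simp: X_def space_PiM)
  also have "?C (Suc t) X = (\<integral>\<^sup>+h. indicator X h \<partial>?C (Suc t))"
    using X sets_C[OF start, of "Suc t"] by (simp del: C.simps)
  also have "\<dots> = J t 0"
    unfolding J_def using space_C[OF start, of "Suc t"]
    by (intro nn_integral_cong) (simp add: av_X del: C.simps avoid_prob.simps)
  finally show ?thesis using J[of t 0] by simp
qed

text \<open>All laws have finite support, so the integrals are finite sums; exchanging the sums over
  actions and states produces the averaged kernel. The state \<open>s\<close> may be the target,
  since only later states are tested.\<close>

lemma avoid_prob_eq_survival:
  fixes p :: "'s \<Rightarrow> 'a \<Rightarrow> 's pmf"
  assumes fin: "finite S" and A: "\<And>z. z \<in> S \<Longrightarrow> finite (A z)" "\<And>z. z \<in> S \<Longrightarrow> set_pmf (\<sigma> z) \<subseteq> A z"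
    and p: "\<And>z a. z \<in> S \<Longrightarrow> a \<in> A z \<Longrightarrow> set_pmf (p z a) \<subseteq> S"
    and s: "s \<in> S"
  shows "(\<integral>\<^sup>+a. avoid_prob p target \<sigma> t (s, a) \<partial>\<sigma> s) =
    ennreal (survival (S - {target}) (\<lambda>s z. \<Sum>a\<in>A s. pmf (\<sigma> s) a * pmf (p s a) z) t s)"
  using s
proof (induction t arbitrary: s)
  case 0
  then show ?case by simp
next
  case (Suc t)
  let ?I = "S - {target}"
  let ?Q = "\<lambda>s z. \<Sum>a\<in>A s. pmf (\<sigma> s) a * pmf (p s a) z"
  have nonneg: "survival ?I ?Q t z \<ge> 0" for z
    by (intro survival_nonneg sum_nonneg mult_nonneg_nonneg) auto
  have "(\<integral>\<^sup>+a. avoid_prob p target \<sigma> (Suc t) (s, a) \<partial>\<sigma> s) =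
    (\<Sum>a\<in>A s. avoid_prob p target \<sigma> (Suc t) (s, a) * ennreal (pmf (\<sigma> s) a))"
    using A(1)[OF Suc.prems] A(2)[OF Suc.prems] by (intro nn_integral_measure_pmf_support) auto
  also have "\<dots> = (\<Sum>a\<in>A s. ennreal (\<Sum>z\<in>?I. pmf (p s a) z * survival ?I ?Q t z) * ennreal (pmf (\<sigma> s) a))"
  proof (rule sum.cong[OF refl])
    fix a assume a: "a \<in> A s"
    \<comment> \<open>The indicator removes the target from the support, leaving a sum over
      \<open>?I\<close>.\<close>
    have "avoid_prob p target \<sigma> (Suc t) (s, a) =
      (\<Sum>z\<in>?I. (indicator (- {target}) z * (\<integral>\<^sup>+a. avoid_prob p target \<sigma> t (z, a) \<partial>\<sigma> z)) * ennreal (pmf (p s a) z))"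
      unfolding avoid_prob.simps fst_conv snd_conv using p[OF Suc.prems a] fin
      by (intro nn_integral_measure_pmf_support) (auto simp: indicator_def)
    also have "\<dots> = (\<Sum>z\<in>?I. ennreal (pmf (p s a) z * survival ?I ?Q t z))"
      using Suc.IH nonneg by (intro sum.cong) (auto simp: ennreal_mult mult.commute)
    also have "\<dots> = ennreal (\<Sum>z\<in>?I. pmf (p s a) z * survival ?I ?Q t z)"
      using nonneg by (intro sum_ennreal) auto
    finally show "avoid_prob p target \<sigma> (Suc t) (s, a) * ennreal (pmf (\<sigma> s) a) =
        ennreal (\<Sum>z\<in>?I. pmf (p s a) z * survival ?I ?Q t z) * ennreal (pmf (\<sigma> s) a)" by simp
  qed
  also have "\<dots> = (\<Sum>a\<in>A s. ennreal ((\<Sum>z\<in>?I. pmf (p s a) z * survival ?I ?Q t z) * pmf (\<sigma> s) a))"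
    using nonneg by (intro sum.cong refl ennreal_mult[symmetric] sum_nonneg mult_nonneg_nonneg) auto
  also have "\<dots> = ennreal (\<Sum>a\<in>A s. (\<Sum>z\<in>?I. pmf (p s a) z * survival ?I ?Q t z) * pmf (\<sigma> s) a)"
    using nonneg by (intro sum_ennreal sum_nonneg mult_nonneg_nonneg) auto
  also have "(\<Sum>a\<in>A s. (\<Sum>z\<in>?I. pmf (p s a) z * survival ?I ?Q t z) * pmf (\<sigma> s) a) =
      survival ?I ?Q (Suc t) s"
    unfolding survival.simps sum_distrib_right by (subst sum.swap) (simp add: mult_ac)
  finally show ?case .
qed

text \<open>Hitting by period \<open>Suc t\<close> is the complement of avoiding the target at the
  indices 0 to \<open>t\<close>.\<close>

lemma reach_prob_eq_survival:
  fixes p :: "'s \<Rightarrow> 'a \<Rightarrow> 's pmf"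
  assumes "mdp S target A p" "stationary_strategy S A \<sigma>" "s \<in> S - {target}"
  shows "reach_prob p target s \<sigma> (Suc t) =
    1 - survival (S - {target}) (\<lambda>s z. \<Sum>a\<in>A s. pmf (\<sigma> s) a * pmf (p s a) z) t s"
proof -
  let ?H = "history_measure p \<sigma> s"
  let ?V = "{h \<in> space ?H. \<forall>i\<le>t. fst (h i) \<noteq> target}"
  interpret IT: Ionescu_Tulcea "history_kernel p \<sigma> s" "\<lambda>_. count_space UNIV"
    by (rule Ionescu_Tulcea_history_kernel)
  \<comment> \<open>The image of the limit measure under the projection to no coordinates is a
    probability measure, and this forces total mass 1 on the limit measure itself.\<close>
  interpret H: prob_space ?H
    unfolding history_measure_def
  proof (rule prob_space_distrD)
    show "(\<lambda>x. restrict x {}) \<in> measurable IT.PF.lim (PiM {} (\<lambda>_. count_space UNIV))"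
      by (auto simp: measurable_cong_sets[OF IT.PF.sets_lim refl] intro: measurable_restrict_subset)
    show "prob_space (distr IT.PF.lim (PiM {} (\<lambda>_. count_space UNIV)) (\<lambda>x. restrict x {}))"
      by (subst IT.distr_lim) (auto intro: IT.PF.prob_space_P)
  qed
  let ?Q = "\<lambda>s z. \<Sum>a\<in>A s. pmf (\<sigma> s) a * pmf (p s a) z"
  have nonneg: "survival (S - {target}) ?Q t z \<ge> 0" for z
    by (intro survival_nonneg sum_nonneg mult_nonneg_nonneg) auto
  have "emeasure ?H ?V = ennreal (survival (S - {target}) ?Q t s)"
    using assms
    by (subst emeasure_history_avoids, blast, intro avoid_prob_eq_survival)
       (auto simp: mdp_def stationary_strategy_def)
  then have V: "measure ?H ?V = survival (S - {target}) ?Q t s"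
    using nonneg by (simp add: measure_def)
  have "(\<lambda>h. fst (h i)) \<in> measurable ?H (count_space UNIV)" for i
    unfolding measurable_cong_sets[OF sets_history_measure refl]
    by (rule measurable_compose[OF measurable_component_singleton[of i UNIV]]) auto
  then have "?V \<in> sets ?H"
    by measurable
  moreover have "{h \<in> space ?H. hitting_period target h \<le> enat (Suc t)} = space ?H - ?V"
    by (auto simp: hitting_period_le_iff)
  ultimately show ?thesis
    unfolding reach_prob_def using V H.prob_compl[of ?V] by (simp only:)
qed

subsection \<open>Genericity of unique minimisers\<close>

text \<open>By Fubini, with coordinate \<open>j\<close> integrated first: once the others are fixed,
  a single value of it solves the equation, and points are Lebesgue null.\<close>

lemma AE_PiM_lborel_hyperplane:
  fixes c :: "'i \<Rightarrow> real"
  assumes I: "finite I" "j \<in> I" and c: "c j \<noteq> 0"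
  shows "AE x in PiM I (\<lambda>_. lborel). (\<Sum>i\<in>I. c i * x i) \<noteq> d"
proof -
  interpret product_sigma_finite "\<lambda>_::'i. lborel :: real measure" ..
  define J where "J = I - {j}"
  have I_eq: "I = insert j J" and J: "finite J" "j \<notin> J"
    using I by (auto simp: J_def)
  define N where "N = {x \<in> space (PiM I (\<lambda>_. lborel)). (\<Sum>i\<in>I. c i * x i) = d}"
  have N: "N \<in> sets (PiM I (\<lambda>_. lborel))"
    unfolding N_def by measurable
  have "emeasure (PiM I (\<lambda>_. lborel)) N = (\<integral>\<^sup>+x. indicator N x \<partial>PiM (insert j J) (\<lambda>_. lborel))"
    using N by (simp add: I_eq)
  also have "\<dots> = (\<integral>\<^sup>+x. (\<integral>\<^sup>+y. indicator N (x(j := y)) \<partial>lborel) \<partial>PiM J (\<lambda>_. lborel))"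
    using N J by (intro product_nn_integral_insert) (auto simp: I_eq)
  also have "\<dots> = (\<integral>\<^sup>+x. 0 \<partial>PiM J (\<lambda>_. lborel :: real measure))"
  proof (rule nn_integral_cong)
    fix x
    have "(\<integral>\<^sup>+y. indicator N (x(j := y)) \<partial>lborel)
        \<le> (\<integral>\<^sup>+y. indicator {(d - (\<Sum>i\<in>J. c i * x i)) / c j} y \<partial>lborel)"
    proof (rule nn_integral_mono)
      fix y
      have "y = (d - (\<Sum>i\<in>J. c i * x i)) / c j" if "x(j := y) \<in> N"
      proof -
        have "(\<Sum>i\<in>J. c i * (x(j := y)) i) = (\<Sum>i\<in>J. c i * x i)"
          using J by (intro sum.cong) auto
        then have "c j * y + (\<Sum>i\<in>J. c i * x i) = d"
          using that J by (simp add: N_def I_eq)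
        then show ?thesis using c by (simp add: field_simps)
      qed
      then show "indicator N (x(j := y))
          \<le> (indicator {(d - (\<Sum>i\<in>J. c i * x i)) / c j} y :: ennreal)"
        by (auto simp: indicator_def)
    qed
    then show "(\<integral>\<^sup>+y. indicator N (x(j := y)) \<partial>lborel) = 0"
      by simp
  qed
  finally have "emeasure (PiM I (\<lambda>_. lborel)) N = 0" by simp
  with N show ?thesis
    by (intro AE_I[of _ _ N]) (auto simp: N_def)
qed

lemma measurable_simplex_coordinate:
  assumes "i \<in> {1..n}"
  shows "(\<lambda>y. y i) \<in> borel_measurable (simplex_lebesgue n)"
  unfolding measurable_cong_sets[OF sets_simplex_lebesgue refl] simplex_borel_def
  using assms by (intro measurable_restrict_space1 measurable_component_singleton)

lemma measurable_PiM_simplex_coordinate: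
  assumes "i \<in> J" "z \<in> {1..n}"
  shows "(\<lambda>u. u i z) \<in> borel_measurable (PiM J (\<lambda>_. simplex_lebesgue n))"
proof (rule measurable_compose[where f = "\<lambda>u. u i" and g = "\<lambda>y. y z"])
  show "(\<lambda>u. u i) \<in> measurable (PiM J (\<lambda>_. simplex_lebesgue n)) (simplex_lebesgue n)"
    using assms(1) by (rule measurable_component_singleton)
  show "(\<lambda>y. y z) \<in> borel_measurable (simplex_lebesgue n)"
    using assms(2) by (rule measurable_simplex_coordinate)
qed

text \<open>In the first \<open>n - 1\<close> coordinates the domain is cut out by finitely many
  strict inequalities. Almost-everywhere statements on the restricted space rely on its
  measurability.\<close>

lemma simplex_chart_domain_measurable:
  assumes "n \<ge> 1"
  shows "{x. simplex_chart n x \<in> open_simplex n} \<inter> space (PiM {1..<n} (\<lambda>_. lborel))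
    \<in> sets (PiM {1..<n} (\<lambda>_. lborel))"
proof -
  have split: "{1..n} = insert n {1..<n}"
    using assms by auto
  have sum_eq: "(\<Sum>i\<in>{1..<n}. simplex_chart n x i) = (\<Sum>i\<in>{1..<n}. x i)" for x
    by (intro sum.cong) (auto simp: simplex_chart_def)
  have "simplex_chart n x \<in> open_simplex n \<longleftrightarrow>
      (\<forall>i\<in>{1..<n}. 0 < x i \<and> x i < 1) \<and> 0 < 1 - (\<Sum>i\<in>{1..<n}. x i) \<and> 1 - (\<Sum>i\<in>{1..<n}. x i) < 1"
    if "x \<in> space (PiM {1..<n} (\<lambda>_. lborel))" for x
  proof -
    have "simplex_chart n x \<in> extensional {1..n}"
      using that assms by (auto simp: simplex_chart_def space_PiM PiE_def extensional_def)
    moreover have "(\<Sum>i\<in>{1..n}. simplex_chart n x i) = 1"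
      unfolding split by (simp add: sum_eq) (simp add: simplex_chart_def)
    moreover have "(\<forall>i\<in>{1..<n}. simplex_chart n x i \<in> {0<..<1}) \<longleftrightarrow> (\<forall>i\<in>{1..<n}. x i \<in> {0<..<1})"
      by (auto simp: simplex_chart_def)
    moreover have "simplex_chart n x n = 1 - (\<Sum>i\<in>{1..<n}. x i)"
      by (simp add: simplex_chart_def)
    ultimately show ?thesis
      unfolding open_simplex_def PiE_iff mem_Collect_eq unfolding split by auto
  qed
  then have "{x. simplex_chart n x \<in> open_simplex n} \<inter> space (PiM {1..<n} (\<lambda>_. lborel)) =
      {x \<in> space (PiM {1..<n} (\<lambda>_. lborel)). (\<forall>i\<in>{1..<n}. 0 < x i \<and> x i < 1) \<and>
         0 < 1 - (\<Sum>i\<in>{1..<n}. x i) \<and> 1 - (\<Sum>i\<in>{1..<n}. x i) < 1}"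
    by blast
  also have "\<dots> \<in> sets (PiM {1..<n} (\<lambda>_. lborel))"
    by measurable
  finally show ?thesis .
qed

text \<open>The chart leaves the first \<open>n - 1\<close> coordinates unchanged, so the preimage
  of the hyperplane is a hyperplane in the flat product space.\<close>

lemma AE_simplex_lebesgue_hyperplane:
  fixes c :: "nat \<Rightarrow> real"
  assumes j: "j \<in> {1..<n}" and c: "c j \<noteq> 0"
  shows "AE y in simplex_lebesgue n. (\<Sum>i\<in>{1..<n}. c i * y i) \<noteq> d"
proof -
  have n: "n \<ge> 1" using j by auto
  have "AE x in PiM {1..<n} (\<lambda>_. lborel). (\<Sum>i\<in>{1..<n}. c i * simplex_chart n x i) \<noteq> d"
  proof -
    have "(\<Sum>i\<in>{1..<n}. c i * simplex_chart n x i) = (\<Sum>i\<in>{1..<n}. c i * x i)" for x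
      by (intro sum.cong) (auto simp: simplex_chart_def)
    then show ?thesis using AE_PiM_lborel_hyperplane[of "{1..<n}" j c d] j c by simp
  qed
  moreover have "(\<lambda>y. \<Sum>i\<in>{1..<n}. c i * y i) \<in> borel_measurable (simplex_borel n)"
    unfolding measurable_cong_sets[OF sets_simplex_lebesgue[symmetric] refl]
    by (intro borel_measurable_sum borel_measurable_times borel_measurable_const
          measurable_simplex_coordinate) auto
  then have "{y \<in> space (simplex_borel n). (\<Sum>i\<in>{1..<n}. c i * y i) \<noteq> d} \<in> sets (simplex_borel n)"
    by measurable
  ultimately show ?thesis
    unfolding simplex_lebesgue_def
    by (subst AE_distr_iff[OF measurable_simplex_chart[OF n]])
       (auto simp: AE_restrict_space_iff[OF simplex_chart_domain_measurable[OF n]])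
qed

section \<open>Ties between actions have probability zero\<close>

text \<open>A law with a density is absolutely continuous with respect to the reference
  measure.\<close>

lemma (in prob_space) AE_distributed_transfer:
  assumes "distributed M N Y f" "AE y in N. P y"
  shows "AE y in distr M N Y. P y"
proof -
  have "f \<in> borel_measurable N"
    using assms(1) by (simp add: distributed_def)
  then show ?thesis
    unfolding distributed_distr_eq_density[OF assms(1)]
    using assms(2) by (auto simp: AE_density elim: eventually_mono)
qed

text \<open>The limit vector is a function of the rows \<open>(z, f z)\<close>, which are
  independent of the row \<open>(s, b)\<close> because \<open>b \<noteq> f s\<close>. With those
  rows fixed, a tie confines the row \<open>(s, b)\<close> to a hyperplane, which is null for a law
  with a density.\<close>

lemma (in prob_space) AE_distinct_values:
  fixes p :: "'a \<Rightarrow> nat \<Rightarrow> 'b \<Rightarrow> nat pmf"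
  assumes n: "n \<ge> 2"
    and indep: "indep_vars (\<lambda>_. simplex_lebesgue n)
       (\<lambda>(s, a) \<omega>. pmf_vector n (p \<omega> s a)) (SIGMA s:{1..<n}. A s)"
    and f: "f \<in> PiE {1..<n} A" and s: "s \<in> {1..<n}" and b: "b \<in> A s" "b \<noteq> f s"
    and dist: "distributed M (simplex_lebesgue n) (\<lambda>\<omega>. pmf_vector n (p \<omega> s b)) g"
  shows "AE \<omega> in M. (\<Sum>z\<in>{1..<n}. (pmf (p \<omega> s b) z - pmf (p \<omega> s (f s)) z) *
     lim (\<lambda>t. survival {1..<n} (\<lambda>s. pmf (p \<omega> s (f s))) t z
           / survival {1..<n} (\<lambda>s. pmf (p \<omega> s (f s))) t 1)) \<noteq> 0"
proof -
  let ?I = "{1..<n}" and ?S = "simplex_lebesgue n"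
  \<comment> \<open>\<open>?U\<close> collects the rows used by \<open>f\<close>. \<open>?V\<close>
    holds the competing row as a family over the singleton \<open>{(s, b)}\<close>, the form in
    which independence of disjoint subfamilies is available.\<close>
  let ?B = "(\<lambda>z. (z, f z)) ` ?I"
  let ?X = "\<lambda>(s, a) \<omega>. pmf_vector n (p \<omega> s a)"
  let ?U = "\<lambda>\<omega>. restrict (\<lambda>i. ?X i \<omega>) ?B" and ?Y = "\<lambda>\<omega>. pmf_vector n (p \<omega> s b)"
  let ?N = "PiM {(s, b)} (\<lambda>_. ?S)" and ?V = "\<lambda>\<omega>. restrict (\<lambda>i. ?X i \<omega>) {(s, b)}"
  have "indep_var (PiM ?B (\<lambda>_. ?S)) ?U ?N ?V"
    using f s b by (intro indep_var_restrict[OF indep]) auto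
  then have joint: "distr M (PiM ?B (\<lambda>_. ?S)) ?U \<Otimes>\<^sub>M distr M ?N ?V =
      distr M (PiM ?B (\<lambda>_. ?S) \<Otimes>\<^sub>M ?N) (\<lambda>\<omega>. (?U \<omega>, ?V \<omega>))"
    and U: "?U \<in> measurable M (PiM ?B (\<lambda>_. ?S))" and V: "?V \<in> measurable M ?N"
    unfolding indep_var_distribution_eq by auto
  define L where "L u z = lim (\<lambda>t. survival ?I (\<lambda>s. u (s, f s)) t z
     / survival ?I (\<lambda>s. u (s, f s)) t 1)" for u z
  define \<Phi> where "\<Phi> u y = (\<Sum>z\<in>?I. (y z - u (s, f s) z) * L u z)" for u y
  have coord: "(\<lambda>u. u (s, f s) z) \<in> borel_measurable (PiM ?B (\<lambda>_. ?S))"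
    if "s \<in> ?I" "z \<in> ?I" for s z
    using that by (intro measurable_PiM_simplex_coordinate) auto
  have surv: "(\<lambda>u. survival ?I (\<lambda>s. u (s, f s)) t z) \<in> borel_measurable (PiM ?B (\<lambda>_. ?S))"
    if "z \<in> ?I" for t z
    using that
  proof (induction t arbitrary: z)
    case (Suc t)
    then show ?case
      unfolding survival.simps by (intro borel_measurable_sum borel_measurable_times coord) auto
  qed simp
  \<comment> \<open>Measurability of \<open>lim\<close> holds for every sequence of measurable
    functions, so convergence is no concern here.\<close>
  have L: "(\<lambda>u. L u z) \<in> borel_measurable (PiM ?B (\<lambda>_. ?S))" if "z \<in> ?I" for z
    unfolding L_def using that n
    by (intro borel_measurable_lim_metric borel_measurable_divide surv) auto
  have coord_V: "(\<lambda>y. y (s, b) z) \<in> borel_measurable ?N" if "z \<in> ?I" for z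
    using that by (intro measurable_PiM_simplex_coordinate) auto
  have \<Phi>: "(\<lambda>x. \<Phi> (fst x) (snd x (s, b))) \<in> borel_measurable (PiM ?B (\<lambda>_. ?S) \<Otimes>\<^sub>M ?N)"
    unfolding \<Phi>_def using s
    by (intro borel_measurable_sum borel_measurable_times borel_measurable_diff
          measurable_compose[OF measurable_fst coord] measurable_compose[OF measurable_fst L]
          measurable_compose[OF measurable_snd coord_V]) auto
  have \<Phi>_V: "(\<lambda>y. \<Phi> u (y (s, b))) \<in> borel_measurable ?N" for u
    unfolding \<Phi>_def
    by (intro borel_measurable_sum borel_measurable_times borel_measurable_diff borel_measurable_const coord_V)
      simp
  interpret D1: prob_space "distr M (PiM ?B (\<lambda>_. ?S)) ?U"
    using U by (rule prob_space_distr)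
  interpret D2: prob_space "distr M ?N ?V"
    using V by (rule prob_space_distr)
  interpret D: pair_sigma_finite "distr M (PiM ?B (\<lambda>_. ?S)) ?U" "distr M ?N ?V" ..
  have "AE x in distr M (PiM ?B (\<lambda>_. ?S)) ?U \<Otimes>\<^sub>M distr M ?N ?V. \<Phi> (fst x) (snd x (s, b)) \<noteq> 0"
  proof (rule D.AE_pair_measure)
    have "{x \<in> space (PiM ?B (\<lambda>_. ?S) \<Otimes>\<^sub>M ?N). \<Phi> (fst x) (snd x (s, b)) \<noteq> 0} \<in> sets (PiM ?B (\<lambda>_. ?S) \<Otimes>\<^sub>M ?N)"
      using \<Phi> by measurable
    then show "{x \<in> space (distr M (PiM ?B (\<lambda>_. ?S)) ?U \<Otimes>\<^sub>M distr M ?N ?V). \<Phi> (fst x) (snd x (s, b)) \<noteq> 0}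
        \<in> sets (distr M (PiM ?B (\<lambda>_. ?S)) ?U \<Otimes>\<^sub>M distr M ?N ?V)"
      unfolding joint by (simp only: space_distr sets_distr)
    show "AE u in distr M (PiM ?B (\<lambda>_. ?S)) ?U. AE y in distr M ?N ?V.
        \<Phi> (fst (u, y)) (snd (u, y) (s, b)) \<noteq> 0"
    proof (rule AE_I2)
      fix u assume "u \<in> space (distr M (PiM ?B (\<lambda>_. ?S)) ?U)"
      then have u: "u (z, f z) \<in> open_simplex n" if "z \<in> ?I" for z
        using that by (auto simp: space_PiM space_simplex_lebesgue)
      have pos: "survival ?I (\<lambda>s. u (s, f s)) t 1 > 0" for t
        using u n by (intro survival_pos) (auto simp: open_simplex_def PiE_iff)
      \<comment> \<open>The ratio at the reference state 1 is constantly 1, so the hyperplane has a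
        nonzero coefficient.\<close>
      have "L u 1 = 1"
        unfolding L_def using less_imp_neq[OF pos, THEN not_sym] by simp
      then have "AE y in ?S. (\<Sum>z\<in>?I. L u z * y z) \<noteq> (\<Sum>z\<in>?I. u (s, f s) z * L u z)"
        using n by (intro AE_simplex_lebesgue_hyperplane[of 1]) auto
      moreover have "\<Phi> u y = (\<Sum>z\<in>?I. L u z * y z) - (\<Sum>z\<in>?I. u (s, f s) z * L u z)" for y
        unfolding \<Phi>_def left_diff_distrib sum_subtractf by (simp add: mult.commute)
      ultimately have "AE y in ?S. \<Phi> u y \<noteq> 0"
        by simp
      then show "AE y in distr M ?N ?V. \<Phi> (fst (u, y)) (snd (u, y) (s, b)) \<noteq> 0"
      proof -
        assume "AE y in ?S. \<Phi> u y \<noteq> 0"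
        then have "AE y in distr M ?S ?Y. \<Phi> u y \<noteq> 0"
          by (rule AE_distributed_transfer[OF dist])
        then have "AE \<omega> in M. \<Phi> u (?Y \<omega>) \<noteq> 0"
          by (rule AE_distrD[OF distributed_measurable[OF dist]])
        moreover have "{y \<in> space ?N. \<Phi> u (y (s, b)) \<noteq> 0} \<in> sets ?N"
          using \<Phi>_V by measurable
        ultimately show ?thesis
          using V by (simp add: AE_distr_iff)
      qed
    qed
  qed
  from AE_distrD[OF measurable_Pair[OF U V] this[unfolded joint]]
  have "AE \<omega> in M. \<Phi> (?U \<omega>) (?V \<omega> (s, b)) \<noteq> 0"
    by (simp only: fst_conv snd_conv)
  moreover have "\<Phi> (?U \<omega>) (?V \<omega> (s, b)) = (\<Sum>z\<in>?I. (pmf (p \<omega> s b) z - pmf (p \<omega> s (f s)) z) *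
     lim (\<lambda>t. survival ?I (\<lambda>s. pmf (p \<omega> s (f s))) t z / survival ?I (\<lambda>s. pmf (p \<omega> s (f s))) t 1))" for \<omega>
  proof -
    have eq: "?U \<omega> (s, f s) z = pmf (p \<omega> s (f s)) z" if "s \<in> ?I" "z \<in> ?I" for s z
      using that by (simp add: pmf_vector_def)
    have "survival ?I (\<lambda>s. ?U \<omega> (s, f s)) t z = survival ?I (\<lambda>s. pmf (p \<omega> s (f s))) t z"
      if "z \<in> ?I" for t z
      using that by (intro survival_cong eq)
    then have "L (?U \<omega>) z = lim (\<lambda>t. survival ?I (\<lambda>s. pmf (p \<omega> s (f s))) t z
        / survival ?I (\<lambda>s. pmf (p \<omega> s (f s))) t 1)" if "z \<in> ?I" for z
      unfolding L_def using that n by simp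
    then show ?thesis
      unfolding \<Phi>_def using eq[OF s]
      by (intro sum.cong refl arg_cong2[where f = "(*)"]) (auto simp: pmf_vector_def)
  qed
  ultimately show ?thesis by simp
qed

section \<open>From almost sure uniqueness to the overtaking strategy\<close>

theorem theorem10:
  fixes n :: nat
    and A :: "nat \<Rightarrow> 'a set"
    and M :: "'w measure"
    and p :: "'w \<Rightarrow> nat \<Rightarrow> 'a \<Rightarrow> nat pmf"
  assumes "n \<ge> 2"
    and "prob_space M"
    and "\<And>\<omega>. \<omega> \<in> space M \<Longrightarrow> mdp {1..n} n A (p \<omega>)"
    and "prob_space.indep_vars M (\<lambda>_. simplex_lebesgue n)
           (\<lambda>(s, a) \<omega>. pmf_vector n (p \<omega> s a)) (SIGMA s:{1..n} - {n}. A s)"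
    and "\<And>s a. s \<in> {1..n} - {n} \<Longrightarrow> a \<in> A s \<Longrightarrow>
           \<exists>f. distributed M (simplex_lebesgue n) (\<lambda>\<omega>. pmf_vector n (p \<omega> s a)) f"
  shows "AE \<omega> in M. \<exists>\<sigma>. pure_stationary_strategy {1..n} A \<sigma> \<and>
           (\<forall>\<sigma>'. stationary_strategy {1..n} A \<sigma>' \<and> (\<exists>s\<in>{1..n} - {n}. \<sigma>' s \<noteq> \<sigma> s) \<longrightarrow>
              (\<forall>s\<in>{1..n} - {n}. overtakes (p \<omega>) n s \<sigma> \<sigma>'))"
proof -
  interpret M: prob_space M by fact
  let ?I = "{1..<n}"
  have I_eq: "{1..n} - {n} = ?I" by auto
  have indep: "M.indep_vars (\<lambda>_. simplex_lebesgue n)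
      (\<lambda>(s, a) \<omega>. pmf_vector n (p \<omega> s a)) (SIGMA s:?I. A s)"
    using assms(4) unfolding I_eq .
  \<comment> \<open>The action sets do not vary with the draw, so any single outcome reveals that
    they are finite and nonempty.\<close>
  obtain \<omega>0 where "\<omega>0 \<in> space M" using M.not_empty by blast
  then have A: "finite (A s)" "A s \<noteq> {}" if "s \<in> {1..n}" for s
    using assms(3)[of \<omega>0] that by (auto simp: mdp_def)
  have pos: "pmf (p \<omega> s a) z > 0" if \<omega>: "\<omega> \<in> space M" and sa: "s \<in> ?I" "a \<in> A s" and z: "z \<in> ?I" for \<omega> s a z
  proof -
    obtain g where "distributed M (simplex_lebesgue n) (\<lambda>\<omega>. pmf_vector n (p \<omega> s a)) g"
      using assms(5) sa unfolding I_eq by blast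
    from measurable_space[OF distributed_measurable[OF this] \<omega>]
    have "pmf_vector n (p \<omega> s a) \<in> space (simplex_lebesgue n)" .
    then have "pmf_vector n (p \<omega> s a) z \<in> {0<..<1}"
      using z by (auto simp: space_simplex_lebesgue open_simplex_def PiE_iff)
    then show ?thesis
      using z by (simp add: pmf_vector_def)
  qed
  let ?generic = "\<lambda>\<omega> f s b. b \<noteq> f s \<longrightarrow>
      (\<Sum>z\<in>?I. (pmf (p \<omega> s b) z - pmf (p \<omega> s (f s)) z) *
         lim (\<lambda>t. survival ?I (\<lambda>s. pmf (p \<omega> s (f s))) t z
               / survival ?I (\<lambda>s. pmf (p \<omega> s (f s))) t 1)) \<noteq> 0"
  \<comment> \<open>Only finitely many triples of a selection, a state and an action occur, so the
    exceptional null sets can be united.\<close>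
  have "AE \<omega> in M. \<forall>f\<in>PiE ?I A. \<forall>s\<in>?I. \<forall>b\<in>A s. ?generic \<omega> f s b"
  proof (intro eventually_ball_finite ballI)
    show "finite (PiE ?I A)"
      using A(1) by (intro finite_PiE) auto
    show "finite (A s)" if "s \<in> ?I" for s
      using A(1) that by auto
    fix f s b assume f: "f \<in> PiE ?I A" and s: "s \<in> ?I" and b: "b \<in> A s"
    obtain g where g: "distributed M (simplex_lebesgue n) (\<lambda>\<omega>. pmf_vector n (p \<omega> s b)) g"
      using assms(5) s b unfolding I_eq by blast
    show "AE \<omega> in M. ?generic \<omega> f s b"
    proof (cases "b = f s")
      case False
      then show ?thesis
        using M.AE_distinct_values[OF assms(1) indep f s b False g] by simp
    qed simp
  qed simp
  then show ?thesis
  proof (rule AE_mp, intro AE_I2 impI)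
    fix \<omega> assume \<omega>: "\<omega> \<in> space M" and gen: "\<forall>f\<in>PiE ?I A. \<forall>s\<in>?I. \<forall>b\<in>A s. ?generic \<omega> f s b"
    let ?P = "\<lambda>s a. pmf (p \<omega> s a)"
    let ?G = "\<lambda>\<sigma> s z. \<Sum>a\<in>A s. pmf (\<sigma> s) a * ?P s a z"
    note mdp = assms(3)[OF \<omega>]
    have "\<exists>f\<in>PiE ?I A. \<forall>g :: nat \<Rightarrow> 'a pmf.
      (\<forall>s\<in>?I. set_pmf (g s) \<subseteq> A s) \<and> (\<exists>s\<in>?I. g s \<noteq> return_pmf (f s)) \<longrightarrow>
      (\<forall>\<^sub>F t in sequentially. \<forall>s\<in>?I. survival ?I (\<lambda>s. ?P s (f s)) t s < survival ?I (?G g) t s)"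
    proof (rule optimal_selection[where ?s0.0 = 1])
      show "finite ?I" "1 \<in> ?I" using assms(1) by auto
      show "finite (A s)" "A s \<noteq> {}" if "s \<in> ?I" for s
        using A[of s] that by auto
      show "?P s a z > 0" if "s \<in> ?I" "a \<in> A s" "z \<in> ?I" for s a z
        using pos[OF \<omega> that] .
    qed (use gen in blast)
    then obtain f where f: "f \<in> PiE ?I A" and best: "\<forall>g :: nat \<Rightarrow> 'a pmf.
      (\<forall>s\<in>?I. set_pmf (g s) \<subseteq> A s) \<and> (\<exists>s\<in>?I. g s \<noteq> return_pmf (f s)) \<longrightarrow>
      (\<forall>\<^sub>F t in sequentially. \<forall>s\<in>?I. survival ?I (\<lambda>s. ?P s (f s)) t s < survival ?I (?G g) t s)"
      by (rule bexE)
    \<comment> \<open>The action at the target is arbitrary, as play from there on does not affect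
      the hitting period.\<close>
    obtain a where a: "a \<in> A n" using A(2)[of n] assms(1) by auto
    define \<sigma> where "\<sigma> s = return_pmf (if s = n then a else f s)" for s
    have \<sigma>_in: "(if s = n then a else f s) \<in> A s" if "s \<in> {1..n}" for s
      using f a that by (cases "s = n") (auto simp: PiE_iff)
    have pure: "pure_stationary_strategy {1..n} A \<sigma>"
      unfolding pure_stationary_strategy_def stationary_strategy_def
      using \<sigma>_in by (auto simp: \<sigma>_def simp del: if_split)
    have \<sigma>_surv: "survival ?I (?G \<sigma>) t s = survival ?I (\<lambda>s. ?P s (f s)) t s" if "s \<in> ?I" for t s
    proof (rule survival_cong[OF _ that])
      fix s z assume s: "s \<in> ?I" "z \<in> ?I"
      then have "f s \<in> A s" "finite (A s)" using f A(1)[of s] by auto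
      then have "?G \<sigma> s z = (\<Sum>a\<in>A s. if a = f s then ?P s a z else 0)"
        using s by (intro sum.cong) (auto simp: \<sigma>_def indicator_def)
      also have "\<dots> = ?P s (f s) z"
        using \<open>f s \<in> A s\<close> \<open>finite (A s)\<close> by simp
      finally show "?G \<sigma> s z = ?P s (f s) z" .
    qed
    have reach: "reach_prob (p \<omega>) n s \<tau> (Suc t) = 1 - survival ?I (?G \<tau>) t s"
      if "stationary_strategy {1..n} A \<tau>" "s \<in> ?I" for \<tau> s t
      using reach_prob_eq_survival[OF mdp that(1), of s t] that(2) unfolding I_eq by simp
    have "overtakes (p \<omega>) n s \<sigma> \<sigma>'"
      if \<sigma>': "stationary_strategy {1..n} A \<sigma>'" and neq: "\<exists>s\<in>?I. \<sigma>' s \<noteq> \<sigma> s" and s: "s \<in> ?I"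
      for \<sigma>' s
    proof -
      have "\<exists>s\<in>?I. \<sigma>' s \<noteq> return_pmf (f s)"
        using neq by (auto simp: \<sigma>_def)
      then have "\<forall>\<^sub>F t in sequentially. \<forall>s\<in>?I. survival ?I (\<lambda>s. ?P s (f s)) t s < survival ?I (?G \<sigma>') t s"
        using \<sigma>' by (intro best[rule_format]) (auto simp: stationary_strategy_def)
      then obtain T where T: "\<And>t. t \<ge> T \<Longrightarrow>
          survival ?I (\<lambda>s. ?P s (f s)) t s < survival ?I (?G \<sigma>') t s"
        using s unfolding eventually_sequentially by blast
      \<comment> \<open>Period \<open>Suc t'\<close> corresponds to \<open>t'\<close> transitions,
        hence the threshold \<open>Suc T\<close>.\<close>
      have "reach_prob (p \<omega>) n s \<sigma>' t < reach_prob (p \<omega>) n s \<sigma> t" if "t \<ge> Suc T" for t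
      proof -
        obtain t' where t': "t = Suc t'" "t' \<ge> T"
          using \<open>t \<ge> Suc T\<close> by (cases t) auto
        have "stationary_strategy {1..n} A \<sigma>"
          using pure by (simp add: pure_stationary_strategy_def)
        then show ?thesis
          unfolding t'(1) using reach[OF _ s] \<sigma>' T[OF t'(2)] \<sigma>_surv[OF s] by simp
      qed
      then show ?thesis
        unfolding overtakes_def by blast
    qed
    then show "\<exists>\<sigma>. pure_stationary_strategy {1..n} A \<sigma> \<and>
           (\<forall>\<sigma>'. stationary_strategy {1..n} A \<sigma>' \<and> (\<exists>s\<in>{1..n} - {n}. \<sigma>' s \<noteq> \<sigma> s) \<longrightarrow>
              (\<forall>s\<in>{1..n} - {n}. overtakes (p \<omega>) n s \<sigma> \<sigma>'))"
      unfolding I_eq using pure by blast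
  qed
qed

end
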